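(* Let $T=(V,E)$ be a tree with $|V|=p\ge 2$ vertices. Let $\mathbf{C}=(c_{i,j})_{i,j\in V}$ be a symmetric array with $c_i:=c_{i,i}>0$ for all $i\in V$ and $c_{i,j}=c_{j,i}>0$ for all $\{i,j\}\in E$, and for $r\in V$ let $\Phi_r^T:(0,\infty)^p\to(0,\infty)^p$ be the associated transformation (defined in the context). Let $\mathbf{X}=(X_i,\,i\in V)$ be a $p$-dimensional random vector with positive, non-degenerate components. Suppose that for every $r\in V$ which is a leaf of $T$, the components of the random vector $\mathbf{X}_{(r)}=\Phi_r^T(\mathbf{X})=(X_{i,(r)},\,i\in V)$ are independent. Then there exist $\mathbf{a}=(a_i,\,i\in V)\in(0,\infty)^p$ and $c>0$ such that for every leaf $r$ of $T$ $$X_{r,(r)}\sim\mathcal{G}(a_r,\,c\,c_r)$$ and, for every $i\in V\setminus\{r\}$, $$\frac{c_{\mathfrak{p}_r(i),i}}{c_{\mathfrak{p}_r(i)}}\,X_{i,(r)}\sim\mathcal{K}\left(a_i,\;a_{\mathfrak{p}_r(i)}-a_i,\;c\,\frac{c_{\mathfrak{p}_r(i)}\,c_i}{c_{\mathfrak{p}_r(i),i}}\right).$$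
   Context: A tree is a connected acyclic undirected graph $T=(V,E)$; a leaf is a vertex of degree 1. For a fixed root $r\in V$, direct $T$ from $r$ towards the leaves and denote the directed tree by $T_r$. If $\{i,j\}\in E$ is directed from $j$ to $i$, then $i$ is a child of $j$ and $j$ is the parent of $i$. The set of children of $i$ in $T_r$ is denoted $\mathfrak{c}_r(i)$, and the parent of $i\neq r$ in $T_r$ is denoted $\mathfrak{p}_r(i)$. The transformation $\Phi_r^T$ is defined by $\Phi_r^T(s_i,\,i\in V)=(s_{i,(r)},\,i\in V)$, where $$s_{i,(r)}=s_i\prod_{j\in\mathfrak{c}_r(i)}\left(1+\frac{c_{i,j}}{c_i}\,s_{j,(r)}\right),$$ an empty product being equal to $1$ (so $s_{i,(r)}=s_i$ if $i\ne r$ is a leaf); the definition is recursive, starting from the vertices at maximal distance from the root $r$. For $a>0$, $b\in\mathbb{R}$, $c>0$, the Kummer distribution $\mathcal{K}(a,b,c)$ is the probability distribution on $(0,\infty)$ with density proportional to $\dfrac{x^{a-1}e^{-cx}}{(1+x)^{a+b}}\,I_{(0,\infty)}(x)$. For $b>0$, $c>0$, the gamma distribution $\mathcal{G}(b,c)$ is the probability distribution on $(0,\infty)$ with density proportional to $y^{b-1}e^{-cy}I_{(0,\infty)}(y)$. A random variable is non-degenerate if it is not almost surely constant. *)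

theory Defs
  imports "HOL-Probability.Probability"
begin

section \<open>Undirected trees\<close>

definition simple_graph :: "'v set \<Rightarrow> 'v set set \<Rightarrow> bool" where
  "simple_graph V E \<longleftrightarrow>
     finite V \<and> (\<forall>e\<in>E. \<exists>u\<in>V. \<exists>v\<in>V. u \<noteq> v \<and> e = {u, v})"

definition walk :: "'v set \<Rightarrow> 'v set set \<Rightarrow> 'v list \<Rightarrow> bool" where
  "walk V E xs \<longleftrightarrow>
     xs \<noteq> [] \<and> set xs \<subseteq> V \<and> successively (\<lambda>u v. {u, v} \<in> E) xs"

definition graph_connected :: "'v set \<Rightarrow> 'v set set \<Rightarrow> bool" where
  "graph_connected V E \<longleftrightarrow>
     V \<noteq> {} \<and> (\<forall>u\<in>V. \<forall>v\<in>V. \<exists>xs. walk V E xs \<and> hd xs = u \<and> last xs = v)"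

text \<open>The closing edge of a cycle joins the last vertex to the first one. At least three
  vertices are required: traversing an undirected edge back and forth is not a cycle.\<close>

definition graph_cycle :: "'v set \<Rightarrow> 'v set set \<Rightarrow> 'v list \<Rightarrow> bool" where
  "graph_cycle V E xs \<longleftrightarrow>
     walk V E xs \<and> distinct xs \<and> length xs \<ge> 3 \<and> {last xs, hd xs} \<in> E"

definition is_tree :: "'v set \<Rightarrow> 'v set set \<Rightarrow> bool" where
  "is_tree V E \<longleftrightarrow>
     simple_graph V E \<and> graph_connected V E \<and> \<not> (\<exists>xs. graph_cycle V E xs)"

definition vertex_degree :: "'v set set \<Rightarrow> 'v \<Rightarrow> nat" where
  "vertex_degree E v = card {e \<in> E. v \<in> e}"

definition leaf :: "'v set \<Rightarrow> 'v set set \<Rightarrow> 'v \<Rightarrow> bool" where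
  "leaf V E v \<longleftrightarrow> v \<in> V \<and> vertex_degree E v = 1"

definition graph_dist :: "'v set \<Rightarrow> 'v set set \<Rightarrow> 'v \<Rightarrow> 'v \<Rightarrow> nat" where
  "graph_dist V E u v =
     (LEAST n. \<exists>xs. walk V E xs \<and> hd xs = u \<and> last xs = v \<and> length xs = Suc n)"


section \<open>The rooted tree and the transformation\<close>

text \<open>Directing the tree from the root \<open>r\<close> towards the leaves means directing every edge from its
  endpoint closer to \<open>r\<close> to its endpoint farther from \<open>r\<close>.\<close>

definition children :: "'v set \<Rightarrow> 'v set set \<Rightarrow> 'v \<Rightarrow> 'v \<Rightarrow> 'v set" where
  "children V E r i =
     {j. {i, j} \<in> E \<and> graph_dist V E r j = Suc (graph_dist V E r i)}"

text \<open>Only meaningful for \<open>i \<noteq> r\<close>; see \<open>ex1_parent\<close> and \<open>children_parent\<close> below.\<close>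

definition parent :: "'v set \<Rightarrow> 'v set set \<Rightarrow> 'v \<Rightarrow> 'v \<Rightarrow> 'v" where
  "parent V E r i = (THE j. i \<in> children V E r j)"

text \<open>Recursion from the children to the parent. The child relation of a finite graph is
  well-founded, so that the recursive equation \<open>Phi_rec\<close> holds.\<close>

definition Phi ::
    "'v set \<Rightarrow> 'v set set \<Rightarrow> ('v \<Rightarrow> 'v \<Rightarrow> real) \<Rightarrow> 'v \<Rightarrow> ('v \<Rightarrow> real) \<Rightarrow> 'v \<Rightarrow> real" where
  "Phi V E C r s =
     wfrec {(j, i). j \<in> children V E r i}
       (\<lambda>t i. s i * (\<Prod>j\<in>children V E r i. 1 + C i j / C i i * t j))"

lemma wf_children:
  assumes "simple_graph V E"
  shows "wf {(j, i). j \<in> children V E r i}"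
proof (rule wf_subset[OF wf_measure])
  let ?m = "\<lambda>i. card {k \<in> V. graph_dist V E r k > graph_dist V E r i}"
  have "?m j < ?m i" if "j \<in> children V E r i" for i j
  proof (rule psubset_card_mono)
    show "finite {k \<in> V. graph_dist V E r i < graph_dist V E r k}"
      using assms by (simp add: simple_graph_def)
    have "{i, j} \<in> E" and d: "graph_dist V E r j = Suc (graph_dist V E r i)"
      using that by (auto simp: children_def)
    then have "j \<in> V"
      using assms unfolding simple_graph_def by (metis insertCI insertE singletonD)
    then have "j \<in> {k \<in> V. graph_dist V E r i < graph_dist V E r k}
        - {k \<in> V. graph_dist V E r j < graph_dist V E r k}"
      using d by simp
    moreover have "{k \<in> V. graph_dist V E r j < graph_dist V E r k}
        \<subseteq> {k \<in> V. graph_dist V E r i < graph_dist V E r k}"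
      unfolding d by (intro Collect_mono) simp
    ultimately show "{k \<in> V. graph_dist V E r j < graph_dist V E r k}
        \<subset> {k \<in> V. graph_dist V E r i < graph_dist V E r k}"
      by blast
  qed
  then show "{(j, i). j \<in> children V E r i} \<subseteq> Wellfounded.measure ?m"
    by auto
qed

lemma Phi_rec:
  assumes "simple_graph V E"
  shows "Phi V E C r s i =
    s i * (\<Prod>j\<in>children V E r i. 1 + C i j / C i i * Phi V E C r s j)"
  unfolding Phi_def
  by (subst wfrec[OF wf_children[OF assms]], rule arg_cong2[where f = "(*)"], simp,
      rule prod.cong, simp_all add: cut_def)

lemma graph_dist_le:
  assumes "walk V E xs"
  shows "graph_dist V E (hd xs) (last xs) \<le> length xs - 1"
  unfolding graph_dist_def
  by (rule Least_le) (use assms in \<open>auto simp: walk_def intro!: exI[of _ xs]\<close>)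

lemma graph_dist_attained:
  assumes "graph_connected V E" "u \<in> V" "v \<in> V"
  obtains xs where "walk V E xs" "hd xs = u" "last xs = v"
    "length xs = Suc (graph_dist V E u v)"
proof -
  obtain ys where "walk V E ys" "hd ys = u" "last ys = v"
    using assms by (auto simp: graph_connected_def)
  moreover have "length ys = Suc (length ys - 1)"
    using calculation by (cases ys) (auto simp: walk_def)
  ultimately have "\<exists>n xs. walk V E xs \<and> hd xs = u \<and> last xs = v \<and> length xs = Suc n"
    by blast
  from LeastI_ex[OF this] show thesis
    using that unfolding graph_dist_def by blast
qed

lemma ex_parent:
  assumes "graph_connected V E" "r \<in> V" "i \<in> V" "i \<noteq> r"
  shows "\<exists>j\<in>V. i \<in> children V E r j"
proof -
  obtain xs where xs: "walk V E xs" "hd xs = r" "last xs = i"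
      "length xs = Suc (graph_dist V E r i)"
    using graph_dist_attained assms by metis
  then obtain ys where ys: "xs = ys @ [i]"
    by (metis append_butlast_last_id walk_def)
  with xs assms have ne: "ys \<noteq> []"
    by auto
  let ?j = "last ys"
  have w: "walk V E ys" and e: "{?j, i} \<in> E" and jV: "?j \<in> V"
    using xs(1) ne by (auto simp: ys walk_def successively_append_iff)
  have "hd ys = r"
    using xs(2) ne by (simp add: ys)
  then have le: "graph_dist V E r ?j \<le> length ys - 1"
    using graph_dist_le[OF w] by simp
  obtain zs where zs: "walk V E zs" "hd zs = r" "last zs = ?j"
      "length zs = Suc (graph_dist V E r ?j)"
    using graph_dist_attained assms(1,2) jV by metis
  have "walk V E (zs @ [i])"
    using zs e assms(3) by (auto simp: walk_def successively_append_iff)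
  from graph_dist_le[OF this] have "graph_dist V E r i \<le> Suc (graph_dist V E r ?j)"
    using zs by (auto simp: walk_def)
  moreover have "length ys = graph_dist V E r i"
    using xs(4) by (simp add: ys)
  ultimately have "graph_dist V E r i = Suc (graph_dist V E r ?j)"
    using le ne by (cases ys) auto
  with e jV show ?thesis
    by (auto simp: children_def)
qed

lemma path_same_dist:
  assumes "graph_connected V E" "r \<in> V"
  shows "\<lbrakk>j \<in> V; k \<in> V; j \<noteq> k; graph_dist V E r j = d; graph_dist V E r k = d\<rbrakk> \<Longrightarrow>
    \<exists>xs. walk V E xs \<and> distinct xs \<and> hd xs = j \<and> last xs = k \<and>
      (\<forall>x\<in>set xs. graph_dist V E r x \<le> d)"
proof (induction d arbitrary: j k)
  case 0
  have "i = r" if "i \<in> V" "graph_dist V E r i = 0" for i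
    using ex_parent[OF assms that(1)] that(2) by (auto simp: children_def)
  with 0 show ?case by metis
next
  case (Suc d)
  have "graph_dist V E r r = 0"
    using graph_dist_le[of V E "[r]"] assms by (simp add: walk_def)
  with Suc.prems have "j \<noteq> r" "k \<noteq> r"
    by auto
  then obtain j' k' where j': "j' \<in> V" "j \<in> children V E r j'"
      and k': "k' \<in> V" "k \<in> children V E r k'"
    using ex_parent[OF assms] Suc.prems by metis
  then have d: "graph_dist V E r j' = d" "graph_dist V E r k' = d"
    using Suc.prems by (auto simp: children_def)
  obtain xs where xs: "walk V E xs" "distinct xs" "hd xs = j'" "last xs = k'"
      "\<forall>x\<in>set xs. graph_dist V E r x \<le> d"
  proof (cases "j' = k'")
    case True
    then show thesis
      using that[of "[j']"] j' d by (simp add: walk_def)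
  next
    case False
    then show thesis
      using Suc.IH[OF j'(1) k'(1) False d] that by blast
  qed
  have ne: "xs \<noteq> []"
    using xs(1) by (simp add: walk_def)
  have "walk V E (j # xs @ [k])"
    using xs ne Suc.prems j' k'
    by (auto simp: walk_def successively_append_iff successively_Cons children_def
        insert_commute)
  moreover have "distinct (j # xs @ [k])"
    using xs Suc.prems by fastforce
  moreover have "\<forall>x\<in>set (j # xs @ [k]). graph_dist V E r x \<le> Suc d"
    using xs Suc.prems by auto
  ultimately show ?case
    by (intro exI[of _ "j # xs @ [k]"]) simp
qed

lemma ex1_parent:
  assumes T: "is_tree V E" and r: "r \<in> V" and i: "i \<in> V" "i \<noteq> r"
  shows "\<exists>!j. i \<in> children V E r j"
proof -
  have conn: "graph_connected V E"
    using T by (simp add: is_tree_def)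
  have "j = k" if j: "i \<in> children V E r j" and k: "i \<in> children V E r k" for j k
  proof (rule ccontr)
    assume "j \<noteq> k"
    have "{j, i} \<in> E" "{k, i} \<in> E" and
      d: "graph_dist V E r i = Suc (graph_dist V E r j)"
        "graph_dist V E r k = graph_dist V E r j"
      using j k by (auto simp: children_def)
    moreover from this have "j \<in> V" "k \<in> V"
      using T unfolding is_tree_def simple_graph_def by (metis insertCI insertE singletonD)+
    ultimately obtain xs where xs: "walk V E xs" "distinct xs" "hd xs = j" "last xs = k"
        "\<forall>x\<in>set xs. graph_dist V E r x \<le> graph_dist V E r j"
      using path_same_dist[OF conn r _ _ \<open>j \<noteq> k\<close> refl] by metis
    have ne: "xs \<noteq> []"
      using xs(1) by (simp add: walk_def)
    have "length xs \<ge> 2"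
      using xs(3,4) \<open>j \<noteq> k\<close> ne by (cases xs rule: remdups_adj.cases) auto
    moreover have "walk V E (xs @ [i])"
      using xs ne i \<open>{k, i} \<in> E\<close> by (auto simp: walk_def successively_append_iff)
    moreover have "distinct (xs @ [i])"
      using xs d by fastforce
    ultimately have "graph_cycle V E (xs @ [i])"
      using xs ne \<open>{j, i} \<in> E\<close> by (auto simp: graph_cycle_def insert_commute)
    with T show False
      by (auto simp: is_tree_def)
  qed
  with ex_parent[OF conn r i] show ?thesis
    by blast
qed

lemma children_parent:
  assumes "is_tree V E" "r \<in> V" "i \<in> V" "i \<noteq> r"
  shows "i \<in> children V E r (parent V E r i)"
  unfolding parent_def by (rule theI'[OF ex1_parent[OF assms]])


section \<open>Kummer and gamma distributions\<close>

definition normalized_density :: "(real \<Rightarrow> real) \<Rightarrow> real \<Rightarrow> real" where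
  "normalized_density f x = f x / (LINT y|lborel. f y)"

definition kummer_density :: "real \<Rightarrow> real \<Rightarrow> real \<Rightarrow> real \<Rightarrow> real" where
  "kummer_density a b c = normalized_density
     (\<lambda>x. x powr (a - 1) * exp (- c * x) / (1 + x) powr (a + b) * indicator {0<..} x)"

definition gamma_density :: "real \<Rightarrow> real \<Rightarrow> real \<Rightarrow> real" where
  "gamma_density b c = normalized_density
     (\<lambda>y. y powr (b - 1) * exp (- c * y) * indicator {0<..} y)"


section \<open>Non-degenerate random variables\<close>

definition nondegenerate :: "'w measure \<Rightarrow> ('w \<Rightarrow> real) \<Rightarrow> bool" where
  "nondegenerate M X \<longleftrightarrow> \<not> (\<exists>k. AE \<omega> in M. X \<omega> = k)"

end

theory Submission
  imports Defs
begin

text \<open>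
  For an edge \<open>{i, j}\<close> let \<open>F i\<close> be the component at \<open>i\<close> of the transformation rooted at \<open>i\<close>, and
  \<open>m j\<close>, \<open>m i\<close> the components at \<open>j\<close>, \<open>i\<close> of the transformations rooted at \<open>i\<close>, \<open>j\<close>. Rooting at a
  leaf behind \<open>i\<close> shows that \<open>F i\<close> and \<open>m j\<close> are independent, and by symmetry \<open>F j\<close> and \<open>m i\<close> are.
  After rescaling, \<open>X = m j\<close>, \<open>Y = F i\<close>, \<open>U = m i\<close>, \<open>V = F j\<close> satisfy \<open>Y = U (1 + X)\<close> and
  \<open>V = X (1 + U)\<close>, a Kummer-gamma independence property.

  To identify the laws without assuming densities, tilt by
  \<open>exp (- g (X + Y)) = exp (- g (U + V))\<close>. The tilted moments of \<open>X\<^sup>i / (1 + X)\<^sup>j\<close> and of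
  \<open>U\<^sup>j / (1 + U)\<^sup>i\<close> obey Pascal recurrences, and comparing the two shows that the ratios of
  consecutive tilted moments of \<open>Y\<close> and of \<open>V\<close> are arithmetic progressions with a common increment
  \<open>k g\<close>. As functions of \<open>g\<close> these satisfy \<open>k' = - k\<^sup>2\<close>, which forces gamma Laplace transforms. The
  law of \<open>X\<close> follows by writing the joint law of \<open>(X, U)\<close> in two ways. Uniqueness of the gamma
  parameters of each \<open>F i\<close> glues the edges together.
\<close>

section \<open>Laplace transforms and gamma laws\<close>

text \<open>The Taylor polynomials of a characteristic function have the moments as coefficients,
  and for a law on \<open>[-1, 1]\<close> the remainder is at most
  \<open>2 * \<bar>t\<bar> ^ n / fact n\<close>. So both characteristic functions are limits of the
  same sequence \<open>?S\<close>.\<close>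

lemma bounded_moments_determine:
  assumes M: "real_distribution M" and N: "real_distribution N"
    and bM: "AE x in M. \<bar>x\<bar> \<le> 1" and bN: "AE x in N. \<bar>x\<bar> \<le> 1"
    and eq: "\<And>n::nat. (LINT x|M. x ^ n) = (LINT x|N. x ^ n)"
  shows "M = N"
proof (rule Levy_uniqueness[OF M N], rule ext)
  fix t :: real
  let ?S = "\<lambda>n. \<Sum>k\<le>n. ((\<i> * t)^k / fact k) * (LINT x|M. x ^ k)"
  have *: "?S \<longlonglongrightarrow> char K t" if K: "real_distribution K" and b: "AE x in K. \<bar>x\<bar> \<le> 1"
    and e: "\<And>n::nat. (LINT x|M. x ^ n) = (LINT x|K. x ^ n)" for K
  proof -
    interpret K: real_distribution K by fact
    have int: "integrable K (\<lambda>x. x ^ k)" for k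
      by (rule K.integrable_const_bound[where B = 1])
        (use b in \<open>auto elim!: eventually_mono simp: power_abs intro: power_le_one\<close>)
    have le: "cmod (?S n - char K t) \<le> 2 * (\<bar>t\<bar> ^ n / fact n)" for n
    proof -
      have "(LINT x|K. \<bar>x\<bar> ^ n) \<le> (LINT x|K. 1)"
        by (rule integral_mono_AE)
          (use b int[of n] in \<open>auto elim!: eventually_mono simp: integrable_abs[of K "\<lambda>x. x ^ n", unfolded power_abs] intro: power_le_one\<close>)
      then have "(LINT x|K. \<bar>x\<bar> ^ n) \<le> 1" using K.prob_space by simp
      then have "(2*\<bar>t\<bar>^n / fact n) * (LINT x|K. \<bar>x\<bar> ^ n) \<le> (2*\<bar>t\<bar>^n / fact n) * 1"
        by (intro mult_left_mono) auto
      moreover have "cmod (char K t - ?S n) \<le> (2*\<bar>t\<bar>^n / fact n) * (LINT x|K. \<bar>x\<bar> ^ n)"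
        unfolding e by (rule K.char_approx1) (rule int)
      ultimately show ?thesis by (simp add: norm_minus_commute)
    qed
    have "(\<lambda>n. 2 * (\<bar>t\<bar> ^ n / fact n)) \<longlonglongrightarrow> 2 * 0"
      by (intro tendsto_mult tendsto_const)
        (use summable_LIMSEQ_zero[OF summable_exp_generic[of "\<bar>t\<bar>"]] in \<open>simp add: field_simps\<close>)
    then have "(\<lambda>n. 2 * (\<bar>t\<bar> ^ n / fact n)) \<longlonglongrightarrow> 0"
      by simp
    then have "(\<lambda>n. ?S n - char K t) \<longlonglongrightarrow> 0"
      by (rule Lim_null_comparison[OF always_eventually[OF allI[OF le]]])
    then show ?thesis by (rule LIM_zero_cancel)
  qed
  show "char M t = char N t"
    by (rule LIMSEQ_unique[OF *[OF M bM refl] *[OF N bN eq]])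
qed

text \<open>The substitution \<open>w = exp (- x)\<close> turns Laplace values at the naturals into
  moments of a law on the unit interval; \<open>- ln w\<close> undoes it.\<close>

lemma laplace_nat_determines:
  assumes M: "real_distribution M" and N: "real_distribution N"
    and pM: "AE x in M. 0 < x" and pN: "AE x in N. 0 < x"
    and eq: "\<And>n::nat. (LINT x|M. exp (- real n * x)) = (LINT x|N. exp (- real n * x))"
  shows "M = N"
proof -
  have [measurable_cong]: "sets M = sets borel" "sets N = sets borel"
    using M N by (auto simp: real_distribution_def real_distribution_axioms_def)
  have pw: "exp (- x) ^ n = exp (- real n * x)" for x :: real and n
    by (simp add: exp_of_nat_mult[symmetric])
  let ?W = "\<lambda>K. distr K borel (\<lambda>x::real. exp (- x))"
  have "?W M = ?W N"
  proof (rule bounded_moments_determine)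
    show "real_distribution (?W M)"
      by (intro prob_space.real_distribution_distr) (use M in \<open>auto simp: real_distribution_def\<close>)
    show "real_distribution (?W N)"
      by (intro prob_space.real_distribution_distr) (use N in \<open>auto simp: real_distribution_def\<close>)
    show "AE x in ?W M. \<bar>x\<bar> \<le> 1"
      using pM by (subst AE_distr_iff) (auto elim!: eventually_mono)
    show "AE x in ?W N. \<bar>x\<bar> \<le> 1"
      using pN by (subst AE_distr_iff) (auto elim!: eventually_mono)
    show "(LINT x|?W M. x ^ n) = (LINT x|?W N. x ^ n)" for n
      using eq[of n] by (simp add: integral_distr pw)
  qed
  then have "distr (?W M) borel (\<lambda>w. - ln w) = distr (?W N) borel (\<lambda>w. - ln w)"
    by simp
  moreover have "distr (?W K) borel (\<lambda>w. - ln w) = K" if "sets K = sets borel" for K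
  proof -
    have [measurable_cong]: "sets K = sets borel" by fact
    show ?thesis
      by (subst distr_distr) (auto simp: comp_def distr_id2 that)
  qed
  ultimately show ?thesis
    using \<open>sets M = sets borel\<close> \<open>sets N = sets borel\<close> by metis
qed

section \<open>Exponentially tilted moments and their derivatives\<close>

text \<open>One term of the exponential series is at most the whole sum. As the bound is uniform in
  \<open>y\<close>, it makes all tilted moments finite.\<close>

lemma power_exp_le:
  fixes y g :: real
  assumes "0 \<le> y" "0 < g"
  shows "y ^ n * exp (- g * y) \<le> fact n / g ^ n"
proof -
  have "(g * y) ^ n /\<^sub>R fact n \<le> (\<Sum>k. (g * y) ^ k /\<^sub>R fact k)"
    using sum_le_suminf[OF summable_exp_generic[of "g * y"], of "{n}"] assms by simp
  then have "(g * y) ^ n / fact n \<le> exp (g * y)"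
    by (simp add: exp_def field_simps)
  then show ?thesis
    using assms by (simp add: exp_minus field_simps power_mult_distrib)
qed

text \<open>Lagrange remainder of second order; it controls the difference quotients of
  \<open>lap\<close>.\<close>

lemma exp_second_order_bound:
  fixes x :: real
  shows "\<bar>exp x - 1 - x\<bar> \<le> x\<^sup>2 * exp \<bar>x\<bar>"
proof -
  have "\<exists>t. \<bar>t\<bar> \<le> \<bar>x\<bar> \<and> exp x = (\<Sum>m<2. x ^ m / fact m) + exp t / fact 2 * x ^ 2"
    by (rule Maclaurin_exp_le)
  then obtain t where t: "\<bar>t\<bar> \<le> \<bar>x\<bar>" "exp x = 1 + x + exp t / 2 * x\<^sup>2"
    by (auto simp: numeral_2_eq_2)
  have "exp t / 2 \<le> exp \<bar>x\<bar>"
    using t(1) by (smt (verit) exp_gt_zero exp_le_cancel_iff field_sum_of_halves)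
  then have "exp t / 2 * x\<^sup>2 \<le> exp \<bar>x\<bar> * x\<^sup>2"
    by (rule mult_right_mono) simp
  with t(2) show ?thesis
    by (simp add: mult.commute)
qed

text \<open>Moments of the unnormalized tilt by \<open>exp (- g * Y)\<close>. For positive
  \<open>Y\<close> and \<open>g\<close>, \<open>lap M Y 0\<close> is the Laplace transform and
  \<open>lap M Y n\<close> is \<open>(- 1) ^ n\<close> times its n-th derivative.\<close>

definition lap :: "'w measure \<Rightarrow> ('w \<Rightarrow> real) \<Rightarrow> nat \<Rightarrow> real \<Rightarrow> real" where
  "lap M Y n g = (LINT \<omega>|M. Y \<omega> ^ n * exp (- g * Y \<omega>))"

context prob_space
begin

lemma integrable_power_exp:
  assumes [measurable]: "Y \<in> borel_measurable M" and "\<And>\<omega>. 0 < Y \<omega>" and "0 < (g::real)"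
  shows "integrable M (\<lambda>\<omega>. Y \<omega> ^ n * exp (- g * Y \<omega>))"
  by (rule integrable_const_bound[where B = "fact n / g ^ n"])
    (use power_exp_le[OF less_imp_le assms(3)] assms in \<open>auto simp: less_imp_le abs_mult\<close>)

lemma integral_pos_real:
  assumes "integrable M f" "\<And>\<omega>. 0 < (f \<omega> :: real)"
  shows "0 < (LINT \<omega>|M. f \<omega>)"
proof -
  have "(LINT \<omega>|M. f \<omega>) \<noteq> 0"
    using assms integral_nonneg_eq_0_iff_AE[OF assms(1)] AE_const
    by (auto simp: less_imp_le less_imp_neq[symmetric])
  moreover have "0 \<le> (LINT \<omega>|M. f \<omega>)"
    using assms by (intro integral_nonneg_AE) (auto simp: less_imp_le)
  ultimately show ?thesis by simp
qed

lemma lap_pos: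
  assumes "Y \<in> borel_measurable M" "\<And>\<omega>. 0 < Y \<omega>" "0 < (g::real)"
  shows "0 < lap M Y n g"
  unfolding lap_def by (intro integral_pos_real integrable_power_exp) (use assms in auto)

text \<open>Differentiation under the integral: the second-order remainder of the integrand is
  dominated by \<open>h^2\<close> times an integrable function independent of \<open>h\<close>, so
  the difference quotient is off by at most a multiple of \<open>\<bar>h\<bar>\<close>.\<close>

lemma lap_has_derivative:
  assumes Y[measurable]: "Y \<in> borel_measurable M" and pos: "\<And>\<omega>. 0 < Y \<omega>" and g: "0 < (g::real)"
  shows "(lap M Y n has_real_derivative - lap M Y (Suc n) g) (at g)"
  unfolding has_field_derivative_iff
proof -
  let ?B = "lap M Y (n + 2) (g / 2)"
  note int = integrable_power_exp[OF Y pos]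
  have *: "\<bar>(lap M Y n (g + h) - lap M Y n g) / h - - lap M Y (Suc n) g\<bar> \<le> \<bar>h\<bar> * ?B"
    if h: "h \<noteq> 0" "\<bar>h\<bar> < g / 2" for h
  proof -
    have gh: "0 < g + h" "0 < g / 2" using h g by auto
    have eq: "lap M Y n (g + h) - lap M Y n g + h * lap M Y (Suc n) g =
      (LINT \<omega>|M. Y \<omega> ^ n * exp (- (g + h) * Y \<omega>) - Y \<omega> ^ n * exp (- g * Y \<omega>)
         + h * (Y \<omega> ^ Suc n * exp (- g * Y \<omega>)))"
      unfolding lap_def
      using int[OF gh(1), of n] int[OF g, of n] int[OF g, of "Suc n"] by simp
    have "\<bar>lap M Y n (g + h) - lap M Y n g + h * lap M Y (Suc n) g\<bar>
      \<le> (LINT \<omega>|M. h\<^sup>2 * (Y \<omega> ^ (n + 2) * exp (- (g / 2) * Y \<omega>)))"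
      unfolding eq
    proof (rule order_trans[OF integral_abs_bound integral_mono])
      show "integrable M (\<lambda>\<omega>. \<bar>Y \<omega> ^ n * exp (- (g + h) * Y \<omega>) - Y \<omega> ^ n * exp (- g * Y \<omega>)
         + h * (Y \<omega> ^ Suc n * exp (- g * Y \<omega>))\<bar>)"
        using int[OF gh(1), of n] int[OF g, of n] int[OF g, of "Suc n"] by auto
      show "integrable M (\<lambda>\<omega>. h\<^sup>2 * (Y \<omega> ^ (n + 2) * exp (- (g / 2) * Y \<omega>)))"
        using int[OF gh(2), of "n + 2"] by auto
      fix \<omega>
      define y where "y = Y \<omega>"
      have y: "0 < y" using pos by (simp add: y_def)
      have "y ^ n * exp (- (g + h) * y) - y ^ n * exp (- g * y) + h * (y ^ Suc n * exp (- g * y))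
        = y ^ n * exp (- g * y) * (exp (- h * y) - 1 - (- h * y))"
        by (simp add: algebra_simps exp_add[symmetric] exp_diff)
      also have "\<bar>\<dots>\<bar> \<le> y ^ n * exp (- g * y) * ((- h * y)\<^sup>2 * exp \<bar>- h * y\<bar>)"
        unfolding abs_mult[of "y ^ n * exp (- g * y)"]
        using y by (intro mult_mono exp_second_order_bound) auto
      \<comment> \<open>Since \<open>\<bar>h\<bar> < g / 2\<close>, half of the exponential decay
        absorbs the growth of \<open>exp \<bar>h * y\<bar>\<close>; this is why the dominating
        moment is taken at \<open>g / 2\<close>.\<close>
      also have "\<dots> \<le> y ^ n * exp (- g * y) * ((- h * y)\<^sup>2 * exp (g / 2 * y))"
        using y h by (intro mult_left_mono) (auto simp: abs_mult)
      also have "\<dots> = h\<^sup>2 * y ^ (n + 2) * (exp (- g * y) * exp (g / 2 * y))"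
        by (simp add: power_mult_distrib power_add algebra_simps power2_eq_square)
      also have "exp (- g * y) * exp (g / 2 * y) = exp (- (g / 2) * y)"
        by (simp add: exp_add[symmetric] field_simps)
      finally show "\<bar>Y \<omega> ^ n * exp (- (g + h) * Y \<omega>) - Y \<omega> ^ n * exp (- g * Y \<omega>)
         + h * (Y \<omega> ^ Suc n * exp (- g * Y \<omega>))\<bar> \<le> h\<^sup>2 * (Y \<omega> ^ (n + 2) * exp (- (g / 2) * Y \<omega>))"
        by (simp add: y_def mult.assoc)
    qed
    also have "\<dots> = h\<^sup>2 * ?B"
      unfolding lap_def by (rule integral_mult_right_zero)
    finally have "\<bar>lap M Y n (g + h) - lap M Y n g + h * lap M Y (Suc n) g\<bar> \<le> h\<^sup>2 * ?B" .
    then have "\<bar>lap M Y n (g + h) - lap M Y n g + h * lap M Y (Suc n) g\<bar> / \<bar>h\<bar> \<le> h\<^sup>2 * ?B / \<bar>h\<bar>"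
      by (rule divide_right_mono) simp
    also have "h\<^sup>2 * ?B / \<bar>h\<bar> = \<bar>h\<bar> * ?B"
      using h(1) by (cases "0 < h") (simp_all add: power2_eq_square)
    also have "\<bar>lap M Y n (g + h) - lap M Y n g + h * lap M Y (Suc n) g\<bar> / \<bar>h\<bar>
        = \<bar>(lap M Y n (g + h) - lap M Y n g) / h - - lap M Y (Suc n) g\<bar>"
      using h(1) by (simp only: abs_divide[symmetric] add_divide_distrib) simp
    finally show ?thesis .
  qed
  have "((\<lambda>h. \<bar>h\<bar> * ?B) \<longlongrightarrow> 0) (at 0)"
    by (auto intro!: tendsto_eq_intros)
  moreover have "\<forall>\<^sub>F h in at 0. norm ((lap M Y n (g + h) - lap M Y n g) / h - - lap M Y (Suc n) g) \<le> \<bar>h\<bar> * ?B"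
    unfolding eventually_at using * g by (intro exI[of _ "g / 2"]) auto
  ultimately have "((\<lambda>h. (lap M Y n (g + h) - lap M Y n g) / h - - lap M Y (Suc n) g) \<longlongrightarrow> 0) (at 0)"
    by (rule Lim_null_comparison[rotated])
  then have "((\<lambda>h. (lap M Y n (g + h) - lap M Y n g) / h) \<longlongrightarrow> - lap M Y (Suc n) g) (at 0)"
    by (rule LIM_zero_cancel)
  then show "((\<lambda>y. (lap M Y n y - lap M Y n g) / (y - g)) \<longlongrightarrow> - lap M Y (Suc n) g) (at g)"
    by (subst LIM_offset_zero_iff[where a = g]) auto
qed

end

section \<open>Gamma laws from ratios of tilted moments\<close>

text \<open>The differential equation of the Laplace transform of a gamma law with shape
  \<open>b\<close> and rate \<open>c\<close>, whose logarithmic derivative is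
  \<open>- b / (g + c)\<close>. In this form no density is presupposed.\<close>

definition gamma_ratio :: "'w measure \<Rightarrow> ('w \<Rightarrow> real) \<Rightarrow> real \<Rightarrow> real \<Rightarrow> bool" where
  "gamma_ratio M Y b c \<longleftrightarrow> (\<forall>g>0. lap M Y 1 g * (g + c) = b * lap M Y 0 g)"

text \<open>The ratios \<open>G n\<close> of consecutive moments satisfy
  \<open>G n' = - G n * (G (n + 1) - G n)\<close>. If the first two increments both equal
  \<open>k\<close>, subtraction gives \<open>k' = - k^2\<close>, which integrates to
  \<open>1 / k = g + c\<close>.\<close>

lemma (in prob_space) gamma_ratio_of_constant_increments:
  assumes Y: "Y \<in> borel_measurable M" "\<And>\<omega>. 0 < Y \<omega>"
    and k1: "\<And>g. 0 < g \<Longrightarrow> lap M Y 2 g / lap M Y 1 g - lap M Y 1 g / lap M Y 0 g = k g"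
    and k2: "\<And>g. 0 < g \<Longrightarrow> lap M Y 3 g / lap M Y 2 g - lap M Y 2 g / lap M Y 1 g = k g"
    and kpos: "\<And>g. 0 < g \<Longrightarrow> 0 < k g"
  obtains b c where "0 < b" "\<And>g. 0 < g \<Longrightarrow> k g * (g + c) = 1" "gamma_ratio M Y b c"
proof -
  define L where "L n g = lap M Y n g" for n g
  define G where "G n g = L (Suc n) g / L n g" for n g
  have L: "0 < L n g" if "0 < g" for n g
    unfolding L_def by (rule lap_pos) (use Y that in auto)
  have D: "(L n has_real_derivative - L (Suc n) g) (at g)" if "0 < g" for n g
    unfolding L_def using lap_has_derivative[OF Y that, of n] by simp
  have DG: "(G n has_real_derivative - G n g * (G (Suc n) g - G n g)) (at g)" if g: "0 < g" for n g
    unfolding G_def[abs_def]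
    by (rule derivative_eq_intros D g refl | use L[OF g, of n] L[OF g, of "Suc n"] in \<open>simp add: field_simps\<close>)+
  have G: "G 1 g - G 0 g = k g" "G 2 g - G 1 g = k g" if "0 < g" for g
    using k1[OF that] k2[OF that] by (simp_all add: G_def L_def numeral_2_eq_2 numeral_3_eq_3)
  have DG0: "(G 0 has_real_derivative - G 0 g * k g) (at g)" if "0 < g" for g
    using DG[OF that, of 0] G(1)[OF that] by simp
  have Dk: "(k has_real_derivative - (k g)\<^sup>2) (at g)" if g: "0 < g" for g
  \<comment> \<open>\<open>k\<close> is known only on the positive axis, so the derivative of
    \<open>G 1 - G 0\<close> is transferred through agreement near \<open>g\<close>.\<close>
  proof (rule DERIV_cong_ev[THEN iffD1, OF refl _ refl])
    show "\<forall>\<^sub>F x in nhds g. G 1 x - G 0 x = k x"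
      using eventually_nhds_in_open[of "{0<..}" g] g G(1) by (auto elim!: eventually_mono)
    have "((\<lambda>x. G 1 x - G 0 x) has_real_derivative - G 1 g * k g - - G 0 g * k g) (at g)"
      by (intro DERIV_diff DG0 g) (use DG[OF g, of 1] G(2)[OF g] in \<open>simp add: numeral_2_eq_2\<close>)
    then show "((\<lambda>x. G 1 x - G 0 x) has_real_derivative - (k g)\<^sup>2) (at g)"
      using G(1)[OF g] by (simp add: power2_eq_square algebra_simps flip: G(1)[OF g])
  qed
  have const: "\<exists>c. \<forall>x\<in>{0<..}. f x = c" if "\<And>g. 0 < g \<Longrightarrow> (f has_real_derivative 0) (at g)"
    for f :: "real \<Rightarrow> real"
    by (rule has_field_derivative_zero_constant) (use that in \<open>auto intro: has_field_derivative_at_within\<close>)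
  obtain c where c: "1 / k g - g = c" if "0 < g" for g
  proof -
    have "((\<lambda>g. 1 / k g - g) has_real_derivative 0) (at g)" if "0 < g" for g
      by (rule derivative_eq_intros Dk that refl | use kpos[OF that] in \<open>simp add: power2_eq_square\<close>)+
    from const[OF this] show ?thesis using that by auto
  qed
  \<comment> \<open>\<open>G 0\<close> and \<open>k\<close> have the same logarithmic derivative
    \<open>- k\<close>; their constant quotient is the shape.\<close>
  obtain b where b: "G 0 g / k g = b" if "0 < g" for g
  proof -
    have "((\<lambda>g. G 0 g / k g) has_real_derivative 0) (at g)" if "0 < g" for g
      by (rule derivative_eq_intros Dk DG0 that refl | use kpos[OF that] in \<open>simp add: power2_eq_square\<close>)+
    from const[OF this] show ?thesis using that by auto
  qed
  have kc: "k g * (g + c) = 1" if "0 < g" for g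
    using c[OF that] kpos[OF that] by (simp add: field_simps)
  have "0 < b"
    using b[of 1] kpos[of 1] L[of 1 0] L[of 1 1] by (auto simp: G_def)
  moreover have "gamma_ratio M Y b c"
    unfolding gamma_ratio_def
  proof (intro allI impI)
    fix g :: real assume g: "0 < g"
    have "G 0 g * (g + c) = b"
      using b[OF g] kc[OF g] kpos[OF g] by (auto simp: field_simps)
    then show "lap M Y 1 g * (g + c) = b * lap M Y 0 g"
      using L[OF g, of 0] by (simp add: G_def L_def field_simps)
  qed
  ultimately show ?thesis using kc that by blast
qed

text \<open>Total mass one forces \<open>C\<close> to be the reciprocal of the integral of
  \<open>f\<close>, so it is enough to know a density up to a constant factor.\<close>

lemma (in prob_space) distributed_normalized_density:
  assumes [measurable]: "f \<in> borel_measurable borel" "X \<in> borel_measurable M"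
    and f: "\<And>x. 0 \<le> f x" and C: "0 \<le> C"
    and eq: "distr M borel X = density lborel (\<lambda>x. ennreal (C * f x))"
  shows "distributed M lborel X (normalized_density f)"
proof -
  interpret D: prob_space "density lborel (\<lambda>x. ennreal (C * f x))"
    unfolding eq[symmetric] by (rule prob_space_distr) simp
  have "(\<integral>\<^sup>+x. ennreal (C * f x) \<partial>lborel) = ennreal 1"
    using D.emeasure_space_1 by (simp add: emeasure_density)
  then have "(LINT x|lborel. C * f x) = 1"
    by (subst integral_eq_nn_integral) (use f C in auto)
  then have "C * (LINT x|lborel. f x) = 1" by simp
  then have "C = 1 / (LINT x|lborel. f x)"
    by (metis mult_zero_right nonzero_eq_divide_eq zero_neq_one)
  then have "C * f x = normalized_density f x" for x
    by (simp add: normalized_density_def)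
  with eq show ?thesis
    unfolding distributed_def
    by (auto simp: normalized_density_def[abs_def] cong: distr_cong)
qed

definition gamma_kernel :: "real \<Rightarrow> real \<Rightarrow> real \<Rightarrow> real" where
  "gamma_kernel b c y = y powr (b - 1) * exp (- c * y) * indicator {0<..} y"

lemma gamma_kernel_nonneg: "0 \<le> gamma_kernel b c y"
  by (simp add: gamma_kernel_def)

lemma gamma_kernel_measurable [measurable]: "gamma_kernel b c \<in> borel_measurable borel"
  unfolding gamma_kernel_def[abs_def] by measurable

lemma gamma_density_kernel: "gamma_density b c = normalized_density (gamma_kernel b c)"
  by (simp add: gamma_density_def gamma_kernel_def[abs_def])

lemma nn_integral_gamma_kernel:
  assumes "0 < b" "0 < c"
  shows "(\<integral>\<^sup>+y. ennreal (gamma_kernel b c y) \<partial>lborel) = ennreal (Gamma b / c powr b)"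
proof -
  \<comment> \<open>At \<open>y = 0\<close> both sides vanish because \<open>0 powr _\<close> is 0,
    so the closed and the open half-line agree pointwise.\<close>
  have *: "ennreal (indicator {0..} (0 + c * y) * (0 + c * y) powr (b - 1) / exp (0 + c * y))
      = ennreal (c powr (b - 1)) * ennreal (gamma_kernel b c y)" for y
    using assms
    by (cases "0 < y")
      (auto simp: gamma_kernel_def ennreal_mult[symmetric] powr_mult exp_minus field_simps
        indicator_def zero_le_mult_iff)
  have "ennreal (Gamma b) = ennreal c *
      (\<integral>\<^sup>+y. ennreal (indicator {0..} (0 + c * y) * (0 + c * y) powr (b - 1) / exp (0 + c * y)) \<partial>lborel)"
    unfolding Gamma_conv_nn_integral_real[OF assms(1)]
    using assms by (subst nn_integral_real_affine[of _ c 0]) auto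
  also have "\<dots> = ennreal c * (ennreal (c powr (b - 1)) * (\<integral>\<^sup>+y. ennreal (gamma_kernel b c y) \<partial>lborel))"
    unfolding * by (subst nn_integral_cmult) auto
  also have "\<dots> = ennreal (c powr b) * (\<integral>\<^sup>+y. ennreal (gamma_kernel b c y) \<partial>lborel)"
    using assms by (simp add: mult.assoc[symmetric] ennreal_mult[symmetric] powr_mult_base)
  finally have "ennreal (1 / c powr b) * ennreal (Gamma b) =
      ennreal (1 / c powr b) * ennreal (c powr b) * (\<integral>\<^sup>+y. ennreal (gamma_kernel b c y) \<partial>lborel)"
    by (simp add: mult.assoc)
  then show ?thesis
    using assms by (simp add: ennreal_mult[symmetric])
qed

lemma integral_gamma_kernel:
  assumes "0 < b" "0 < c"
  shows "(LINT y|lborel. gamma_kernel b c y) = Gamma b / c powr b"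
proof -
  have "0 \<le> Gamma b / c powr b"
    using Gamma_real_pos[OF assms(1)] by simp
  then show ?thesis
    using nn_integral_gamma_kernel[OF assms]
    by (subst integral_eq_nn_integral) (auto simp: gamma_kernel_nonneg)
qed

text \<open>By the differential equation, \<open>lap M Y 0 g * (g + c) powr b\<close> is constant
  for positive \<open>g\<close>. Letting \<open>g\<close> tend to 0, where the Laplace transform
  tends to 1, identifies the constant as \<open>c powr b\<close>; its positivity then excludes
  \<open>c = 0\<close>.\<close>

lemma (in prob_space) gamma_ratio_laplace:
  assumes Y: "Y \<in> borel_measurable M" "\<And>\<omega>. 0 < Y \<omega>"
    and ratio: "gamma_ratio M Y b c" and b: "0 < b" and c: "\<And>g. 0 < g \<Longrightarrow> 0 < g + c"
  shows "0 < c" and "0 \<le> g \<Longrightarrow> lap M Y 0 g = c powr b / (g + c) powr b"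
proof -
  \<comment> \<open>A negative \<open>c\<close> would violate the hypothesis at
    \<open>g = - c / 2\<close>.\<close>
  have c0: "0 \<le> c"
    using c[of "- c / 2"] by (cases "c < 0") auto
  let ?f = "\<lambda>g. lap M Y 0 g * (g + c) powr b"
  have "\<exists>k. \<forall>g\<in>{0<..}. ?f g = k"
  proof (rule has_field_derivative_zero_constant)
    fix g :: real assume "g \<in> {0<..}"
    then have g: "0 < g" by simp
    have "lap M Y 1 g * (g + c) = b * lap M Y 0 g"
      using ratio g by (auto simp: gamma_ratio_def)
    then have e: "lap M Y (Suc 0) g * (g + c) powr b = lap M Y 0 g * (b * (g + c) powr (b - 1))"
    proof -
      have "(g + c) powr b = (g + c) * (g + c) powr (b - 1)"
        using c[OF g] by (simp add: powr_mult_base)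
      then show ?thesis
        using \<open>lap M Y 1 g * (g + c) = b * lap M Y 0 g\<close>
        by (simp flip: mult.assoc)
    qed
    have "(?f has_real_derivative 0) (at g)"
      by (rule derivative_eq_intros lap_has_derivative[OF Y g, of 0] refl | use c[OF g] e in simp)+
    then show "(?f has_real_derivative 0) (at g within {0<..})"
      by (rule has_field_derivative_at_within)
  qed simp
  then obtain k where k: "\<And>g. 0 < g \<Longrightarrow> ?f g = k"
    by auto
  let ?g = "\<lambda>n. inverse (real (Suc n))"
  have "(\<lambda>n. ?f (?g n)) \<longlonglongrightarrow> 1 * (0 + c) powr b"
  proof (intro tendsto_mult tendsto_powr' tendsto_add LIMSEQ_inverse_real_of_nat tendsto_const)
    have "(\<lambda>n. LINT \<omega>|M. Y \<omega> ^ 0 * exp (- ?g n * Y \<omega>)) \<longlonglongrightarrow> (LINT \<omega>|M. 1)"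
    proof (rule integral_dominated_convergence[where w = "\<lambda>_. 1"])
      show "AE \<omega> in M. (\<lambda>n. Y \<omega> ^ 0 * exp (- ?g n * Y \<omega>)) \<longlonglongrightarrow> 1"
      proof (rule AE_I2)
        fix \<omega>
        have "(\<lambda>n. Y \<omega> ^ 0 * exp (- ?g n * Y \<omega>)) \<longlonglongrightarrow> 1 * exp (- 0 * Y \<omega>)"
          by (intro tendsto_intros LIMSEQ_inverse_real_of_nat) (simp add: tendsto_const)
        then show "(\<lambda>n. Y \<omega> ^ 0 * exp (- ?g n * Y \<omega>)) \<longlonglongrightarrow> 1" by simp
      qed
    qed (use Y in \<open>auto simp: less_imp_le\<close>)
    then show "(\<lambda>n. lap M Y 0 (?g n)) \<longlonglongrightarrow> 1"
      by (simp add: lap_def prob_space)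
    \<comment> \<open>At this point \<open>c = 0\<close> is not yet excluded, so continuity of
      \<open>powr\<close> at base 0 is covered through \<open>0 < b\<close>.\<close>
    show "0 + c \<noteq> 0 \<or> 0 < b \<and> (\<forall>\<^sub>F n in sequentially. 0 \<le> ?g n + c)"
      using b c0 by auto
  qed
  moreover have "(\<lambda>n. ?f (?g n)) = (\<lambda>n. k)"
    by (rule ext, rule k) simp
  ultimately have kc: "k = c powr b"
    using LIMSEQ_unique[OF tendsto_const[of k]] by simp
  have "0 < k"
    using k[of 1] c[of 1] lap_pos[OF Y, of 1 0] by auto
  with kc c0 b show "0 < c" by (cases "c = 0") auto
  then show "lap M Y 0 g = c powr b / (g + c) powr b" if "0 \<le> g"
    using k[of g] that kc by (cases "g = 0") (auto simp: lap_def prob_space field_simps)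
qed

text \<open>Tilting the gamma kernel by \<open>exp (- n * y)\<close> only shifts its rate to
  \<open>n + c\<close>, so its Laplace values at the naturals are the ones already found for
  \<open>Y\<close>.\<close>

lemma (in prob_space) gamma_ratio_distributed:
  assumes Y[measurable]: "Y \<in> borel_measurable M" and pos: "\<And>\<omega>. 0 < Y \<omega>"
    and ratio: "gamma_ratio M Y b c" and b: "0 < b" and c: "0 < c"
  shows "distr M borel Y = density lborel (\<lambda>y. ennreal (c powr b / Gamma b * gamma_kernel b c y))"
    and "distributed M lborel Y (gamma_density b c)"
proof -
  let ?C = "c powr b / Gamma b"
  let ?N = "density lborel (\<lambda>y. ennreal (?C * gamma_kernel b c y))"
  have C: "0 < ?C" using Gamma_real_pos[OF b] c by simp
  show eq: "distr M borel Y = ?N"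
  proof (rule laplace_nat_determines)
    show "real_distribution (distr M borel Y)" by simp
    have "prob_space ?N"
    proof
      show "emeasure ?N (space ?N) = 1"
        using C Gamma_real_pos[OF b] c
        by (simp add: emeasure_density ennreal_mult'[OF less_imp_le[OF C]] nn_integral_cmult
            nn_integral_gamma_kernel[OF b c] del: times_divide_eq_left)
          (simp add: ennreal_mult[symmetric])
    qed
    then show "real_distribution ?N"
      by (simp add: real_distribution_def real_distribution_axioms_def)
    show "AE y in distr M borel Y. 0 < y"
      by (subst AE_distr_iff) (auto simp: pos)
    show "AE y in ?N. 0 < y"
      by (subst AE_density) (auto simp: gamma_kernel_def indicator_def intro!: AE_I2)
    fix n :: nat
    have "(LINT y|?N. exp (- real n * y)) = (LINT y|lborel. ?C * gamma_kernel b c y * exp (- real n * y))"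
      by (subst integral_density)
        (auto intro!: AE_I2 divide_nonneg_pos mult_nonneg_nonneg gamma_kernel_nonneg Gamma_real_pos b)
    also have "\<dots> = (LINT y|lborel. ?C * gamma_kernel b (real n + c) y)"
      by (rule Bochner_Integration.integral_cong)
        (auto simp: gamma_kernel_def algebra_simps exp_add[symmetric])
    also have "\<dots> = ?C * (Gamma b / (real n + c) powr b)"
      using b c by (subst integral_mult_right_zero) (simp add: integral_gamma_kernel)
    also have "\<dots> = lap M Y 0 (real n)"
      using gamma_ratio_laplace(2)[OF Y pos ratio b, of "real n"] c Gamma_real_pos[OF b] by simp
    also have "\<dots> = (LINT y|distr M borel Y. exp (- real n * y))"
      by (subst integral_distr) (auto simp: lap_def)
    finally show "(LINT y|distr M borel Y. exp (- real n * y)) = (LINT y|?N. exp (- real n * y))"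
      by simp
  qed
  show "distributed M lborel Y (gamma_density b c)"
    unfolding gamma_density_kernel
    by (rule distributed_normalized_density[OF _ _ _ _ eq]) (use C in \<open>auto simp: gamma_kernel_nonneg\<close>)
qed

section \<open>Gamma kernels under scaling by a random factor\<close>

text \<open>Substituting \<open>y = (1 + t) * s\<close> produces
  \<open>exp (- c * s) * exp (- c * t * s)\<close>, and the extra exponential in the integrand
  cancels the part containing \<open>t\<close>. What remains of \<open>t\<close> is
  \<open>(1 + t) powr (b - 1)\<close> from the kernel and one factor \<open>1 + t\<close> from the
  Jacobian.\<close>

lemma gamma_kernel_scale:
  fixes f :: "real \<Rightarrow> ennreal"
  assumes [measurable]: "f \<in> borel_measurable borel" and t: "0 < t"
  shows "(\<integral>\<^sup>+y. f (y / (1 + t)) * ennreal (exp (c * t * (y / (1 + t)))) * ennreal (gamma_kernel b c y) \<partial>lborel)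
    = ennreal ((1 + t) powr b) * (\<integral>\<^sup>+s. f s * ennreal (gamma_kernel b c s) \<partial>lborel)"
proof -
  have *: "f ((0 + (1 + t) * s) / (1 + t)) * ennreal (exp (c * t * ((0 + (1 + t) * s) / (1 + t))))
        * ennreal (gamma_kernel b c (0 + (1 + t) * s))
      = ennreal ((1 + t) powr (b - 1)) * (f s * ennreal (gamma_kernel b c s))" for s
  proof -
    have "exp (c * t * s) * gamma_kernel b c ((1 + t) * s) = (1 + t) powr (b - 1) * gamma_kernel b c s"
    proof (cases "0 < s")
      case True
      have "((1 + t) * s) powr (b - 1) = (1 + t) powr (b - 1) * s powr (b - 1)"
        by (rule powr_mult)
      moreover have "exp (c * t * s) * exp (- c * ((1 + t) * s)) = exp (- c * s)"
        by (simp add: exp_add[symmetric] algebra_simps)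
      moreover have "0 < (1 + t) * s" using t True by simp
      ultimately show ?thesis
        using True by (simp add: gamma_kernel_def mult.left_commute)
    next
      case False
      then have "\<not> 0 < (1 + t) * s" using t by (simp add: zero_less_mult_iff)
      with False show ?thesis by (simp add: gamma_kernel_def)
    qed
    moreover have "((1 + t) * s) / (1 + t) = s" using t by simp
    ultimately show ?thesis
      by (simp add: mult.assoc mult.left_commute[of _ "f s"] gamma_kernel_nonneg
          flip: ennreal_mult)
  qed
  have "(\<integral>\<^sup>+y. f (y / (1 + t)) * ennreal (exp (c * t * (y / (1 + t)))) * ennreal (gamma_kernel b c y) \<partial>lborel)
    = ennreal (1 + t) * (\<integral>\<^sup>+s. ennreal ((1 + t) powr (b - 1)) * (f s * ennreal (gamma_kernel b c s)) \<partial>lborel)"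
    using t by (subst nn_integral_real_affine[of _ "1 + t" 0]) (auto simp only: * abs_of_pos, auto)
  also have "\<dots> = ennreal (1 + t) * ennreal ((1 + t) powr (b - 1)) * (\<integral>\<^sup>+s. f s * ennreal (gamma_kernel b c s) \<partial>lborel)"
    by (subst nn_integral_cmult) (auto simp: mult.assoc)
  also have "ennreal (1 + t) * ennreal ((1 + t) powr (b - 1)) = ennreal ((1 + t) powr b)"
    using t by (subst ennreal_mult[symmetric]) (simp_all add: powr_mult_base)
  finally show ?thesis .
qed

text \<open>Integrating over \<open>Y\<close> first, with \<open>s = Y / (1 + X)\<close>, leaves
  \<open>X\<close> only in the power \<open>(1 + X) powr b\<close>, so the expectation splits. When
  \<open>s\<close> is \<open>U\<close>, the weight \<open>exp (c * X * U)\<close> is symmetric in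
  the two variables, which allows a second evaluation from the other side.\<close>

lemma (in prob_space) gamma_tilted_expectation:
  fixes f h :: "real \<Rightarrow> ennreal"
  assumes [measurable]: "f \<in> borel_measurable borel" "h \<in> borel_measurable borel"
    and ind: "indep_var borel X borel Y" and X: "\<And>\<omega>. 0 < X \<omega>"
    and D: "distr M borel Y = density lborel (\<lambda>y. ennreal (C * gamma_kernel b c y))" and C: "0 \<le> C"
  shows "(\<integral>\<^sup>+\<omega>. h (X \<omega>) * f (Y \<omega> / (1 + X \<omega>)) * ennreal (exp (c * X \<omega> * (Y \<omega> / (1 + X \<omega>)))) \<partial>M)
    = (\<integral>\<^sup>+\<omega>. h (X \<omega>) * ennreal ((1 + X \<omega>) powr b) \<partial>M) *
      (ennreal C * (\<integral>\<^sup>+s. f s * ennreal (gamma_kernel b c s) \<partial>lborel))"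
proof -
  have [measurable]: "X \<in> borel_measurable M" "Y \<in> borel_measurable M"
    using ind by (auto simp: indep_var_distribution_eq)
  let ?q = "\<lambda>x y. h x * f (y / (1 + x)) * ennreal (exp (c * x * (y / (1 + x))))"
  let ?J = "\<integral>\<^sup>+s. f s * ennreal (gamma_kernel b c s) \<partial>lborel"
  interpret Y: prob_space "distr M borel Y" by (rule prob_space_distr) simp
  have inner: "(\<integral>\<^sup>+y. ?q x y \<partial>distr M borel Y) = h x * ennreal ((1 + x) powr b) * (ennreal C * ?J)"
    if "0 < x" for x
  proof -
    have "(\<integral>\<^sup>+y. ?q x y \<partial>distr M borel Y) =
      (\<integral>\<^sup>+y. (h x * ennreal C) * (f (y / (1 + x)) * ennreal (exp (c * x * (y / (1 + x)))) * ennreal (gamma_kernel b c y)) \<partial>lborel)"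
      unfolding D using C
      by (subst nn_integral_density) (auto intro!: nn_integral_cong simp: ennreal_mult gamma_kernel_nonneg ac_simps)
    also have "\<dots> = h x * ennreal ((1 + x) powr b) * (ennreal C * ?J)"
      by (subst nn_integral_cmult, simp, subst gamma_kernel_scale[OF _ that])
        (simp_all only: assms ac_simps)
    finally show ?thesis .
  qed
  have "(\<integral>\<^sup>+\<omega>. ?q (X \<omega>) (Y \<omega>) \<partial>M) = (\<integral>\<^sup>+z. case_prod ?q z \<partial>distr M (borel \<Otimes>\<^sub>M borel) (\<lambda>\<omega>. (X \<omega>, Y \<omega>)))"
    by (subst nn_integral_distr) auto
  also have "\<dots> = (\<integral>\<^sup>+z. case_prod ?q z \<partial>(distr M borel X \<Otimes>\<^sub>M distr M borel Y))"
    using ind by (simp add: indep_var_distribution_eq)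
  also have "\<dots> = (\<integral>\<^sup>+x. \<integral>\<^sup>+y. ?q x y \<partial>distr M borel Y \<partial>distr M borel X)"
    by (subst Y.nn_integral_fst[symmetric]) auto
  also have "\<dots> = (\<integral>\<^sup>+\<omega>. (\<integral>\<^sup>+y. ?q (X \<omega>) y \<partial>distr M borel Y) \<partial>M)"
    by (subst nn_integral_distr) auto
  also have "\<dots> = (\<integral>\<^sup>+\<omega>. h (X \<omega>) * ennreal ((1 + X \<omega>) powr b) * (ennreal C * ?J) \<partial>M)"
    by (intro nn_integral_cong inner X)
  also have "\<dots> = (\<integral>\<^sup>+\<omega>. h (X \<omega>) * ennreal ((1 + X \<omega>) powr b) \<partial>M) * (ennreal C * ?J)"
    by (subst nn_integral_multc) auto
  finally show ?thesis .
qed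

section \<open>The Kummer-gamma independence property\<close>

text \<open>The expectation of \<open>h X * \<psi> U * exp (c * X * U)\<close> is evaluated once
  through \<open>(X, Y)\<close> and once through \<open>(U, V)\<close>. With \<open>\<psi>\<close>
  fixed and \<open>h\<close> arbitrary, the law of \<open>X\<close> weighted by
  \<open>(1 + x) powr b\<close> is proportional to the gamma kernel with parameters \<open>a\<close>
  and \<open>c\<close>.\<close>

lemma (in prob_space) kummer_distributed:
  assumes XY: "indep_var borel X borel Y" and UV: "indep_var borel U borel V"
    and X: "\<And>\<omega>. 0 < X \<omega>" and U: "\<And>\<omega>. 0 < U \<omega>"
    and Y_eq: "\<And>\<omega>. Y \<omega> = U \<omega> * (1 + X \<omega>)" and V_eq: "\<And>\<omega>. V \<omega> = X \<omega> * (1 + U \<omega>)"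
    and DY: "distr M borel Y = density lborel (\<lambda>y. ennreal (C1 * gamma_kernel b c y))" and C1: "0 < C1"
    and DV: "distr M borel V = density lborel (\<lambda>y. ennreal (C2 * gamma_kernel a c y))" and C2: "0 < C2"
    and a: "0 < a" and b: "0 < b" and c: "0 < c"
  shows "distributed M lborel X (kummer_density a (b - a) c)"
proof -
  have [measurable]: "X \<in> borel_measurable M" "U \<in> borel_measurable M"
    using XY UV by (auto simp: indep_var_distribution_eq)
  \<comment> \<open>The support in \<open>(0, 1]\<close> bounds \<open>k2\<close> by
    \<open>2 powr a\<close>, while \<open>J\<close> stays positive and finite.\<close>
  define \<psi> :: "real \<Rightarrow> ennreal" where "\<psi> = indicator {0<..1}"
  have [measurable]: "\<psi> \<in> borel_measurable borel" by (simp add: \<psi>_def)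
  define J where "J = (\<integral>\<^sup>+s. \<psi> s * ennreal (gamma_kernel b c s) \<partial>lborel)"
  define k1 where "k1 = ennreal C1 * J"
  define k2 where "k2 = (\<integral>\<^sup>+\<omega>. \<psi> (U \<omega>) * ennreal ((1 + U \<omega>) powr a) \<partial>M)"
  have main: "(\<integral>\<^sup>+\<omega>. h (X \<omega>) * ennreal ((1 + X \<omega>) powr b) \<partial>M) * k1
      = k2 * (ennreal C2 * (\<integral>\<^sup>+s. h s * ennreal (gamma_kernel a c s) \<partial>lborel))"
    if [measurable]: "h \<in> borel_measurable borel" for h :: "real \<Rightarrow> ennreal"
  proof -
    have "Y \<omega> / (1 + X \<omega>) = U \<omega>" "V \<omega> / (1 + U \<omega>) = X \<omega>" for \<omega>
      using X[of \<omega>] U[of \<omega>] by (simp_all add: Y_eq V_eq)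
    then have "(\<integral>\<^sup>+\<omega>. h (X \<omega>) * \<psi> (U \<omega>) * ennreal (exp (c * X \<omega> * U \<omega>)) \<partial>M)
        = (\<integral>\<^sup>+\<omega>. h (X \<omega>) * ennreal ((1 + X \<omega>) powr b) \<partial>M) * k1"
      "(\<integral>\<^sup>+\<omega>. \<psi> (U \<omega>) * h (X \<omega>) * ennreal (exp (c * U \<omega> * X \<omega>)) \<partial>M)
        = k2 * (ennreal C2 * (\<integral>\<^sup>+s. h s * ennreal (gamma_kernel a c s) \<partial>lborel))"
      using gamma_tilted_expectation[OF _ _ XY X DY, of \<psi> h] C1
        gamma_tilted_expectation[OF _ _ UV U DV, of h \<psi>] C2
      by (simp_all add: k1_def k2_def J_def)
    then show ?thesis by (simp add: ac_simps)
  qed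
  \<comment> \<open>The identity \<open>main\<close> is to be divided by \<open>k1\<close> in
    \<open>ennreal\<close>, so \<open>k1\<close> must be neither 0 nor infinite.\<close>
  have "J \<le> (\<integral>\<^sup>+s. ennreal (gamma_kernel b c s) \<partial>lborel)"
    unfolding J_def by (intro nn_integral_mono) (auto simp: \<psi>_def indicator_def)
  then have "J < top"
    unfolding nn_integral_gamma_kernel[OF b c] by (simp add: order_le_less_trans)
  moreover have "J \<noteq> 0"
  proof
    assume "J = 0"
    then have "AE s in lborel. \<psi> s * ennreal (gamma_kernel b c s) = 0"
      unfolding J_def by (subst (asm) nn_integral_0_iff_AE) auto
    then have "AE s in lborel. s \<notin> {0<..1::real}"
      by (rule AE_mp) (auto simp: \<psi>_def gamma_kernel_def indicator_def split: if_splits intro!: AE_I2)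
    then have "emeasure lborel {0<..1::real} = 0"
      by (subst (asm) AE_iff_null_sets[symmetric]) auto
    then show False by simp
  qed
  ultimately have k1: "k1 \<noteq> 0" "k1 \<noteq> top"
    using C1 by (auto simp: k1_def ennreal_mult_eq_top_iff)
  have "k2 \<le> (\<integral>\<^sup>+\<omega>. ennreal (2 powr a) \<partial>M)"
    unfolding k2_def
    by (intro nn_integral_mono) (use a in \<open>auto simp: \<psi>_def indicator_def intro!: powr_mono2\<close>)
  also have "\<dots> < top" by (simp add: emeasure_space_1)
  finally have k2: "k2 < top" .
  define K where "K = enn2real (k2 * ennreal C2 / k1)"
  have K: "ennreal K = k2 * ennreal C2 / k1"
  proof -
    have "k2 * ennreal C2 \<noteq> top"
      using k2 by (simp add: ennreal_mult_eq_top_iff)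
    then have "k2 * ennreal C2 / k1 \<noteq> top"
      using k1 by (simp add: ennreal_divide_eq_top_iff)
    then show ?thesis
      by (simp add: K_def less_top)
  qed
  define f where "f x = (1 + x) powr (- b) * gamma_kernel a c x" for x
  have [measurable]: "f \<in> borel_measurable borel"
    unfolding f_def[abs_def] by measurable
  have f0: "0 \<le> f x" for x by (simp add: f_def gamma_kernel_nonneg)
  have "distr M borel X = density lborel (\<lambda>x. ennreal (K * f x))"
  proof (rule measure_eqI)
    fix A assume "A \<in> sets (distr M borel X)"
    then have [measurable]: "A \<in> sets borel" by simp
    \<comment> \<open>The weight cancels \<open>(1 + X) powr b\<close> in \<open>main\<close> and
      leaves the probability of \<open>A\<close>.\<close>
    define h where "h x = indicator A x * ennreal ((1 + x) powr (- b))" for x :: real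
    have "(\<integral>\<^sup>+\<omega>. h (X \<omega>) * ennreal ((1 + X \<omega>) powr b) \<partial>M) = (\<integral>\<^sup>+\<omega>. indicator A (X \<omega>) \<partial>M)"
    proof (rule nn_integral_cong)
      fix \<omega>
      have "ennreal ((1 + X \<omega>) powr (- b)) * ennreal ((1 + X \<omega>) powr b) = 1"
        using X[of \<omega>] by (simp add: ennreal_mult[symmetric] powr_add[symmetric])
      then show "h (X \<omega>) * ennreal ((1 + X \<omega>) powr b) = indicator A (X \<omega>)"
        by (simp add: h_def mult.assoc)
    qed
    also have "\<dots> = emeasure (distr M borel X) A"
      using nn_integral_distr[of X M borel "indicator A"] by simp
    finally have "emeasure (distr M borel X) A * k1 =
        k2 * (ennreal C2 * (\<integral>\<^sup>+s. h s * ennreal (gamma_kernel a c s) \<partial>lborel))"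
      using main[of h] by (simp add: h_def[abs_def])
    then have "emeasure (distr M borel X) A =
        k2 * (ennreal C2 * (\<integral>\<^sup>+s. h s * ennreal (gamma_kernel a c s) \<partial>lborel)) / k1"
      using k1 by (metis ennreal_mult_divide_eq)
    also have "\<dots> = ennreal K * (\<integral>\<^sup>+s. h s * ennreal (gamma_kernel a c s) \<partial>lborel)"
      unfolding K by (simp add: divide_ennreal_def ac_simps)
    also have "\<dots> = (\<integral>\<^sup>+s. ennreal K * (h s * ennreal (gamma_kernel a c s)) \<partial>lborel)"
      by (subst nn_integral_cmult) (auto simp: h_def)
    also have "\<dots> = (\<integral>\<^sup>+s. ennreal (K * f s) * indicator A s \<partial>lborel)"
      by (rule nn_integral_cong)
        (simp add: h_def f_def ennreal_mult'' gamma_kernel_nonneg ac_simps split: split_indicator)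
    also have "\<dots> = emeasure (density lborel (\<lambda>x. ennreal (K * f x))) A"
      by (simp add: emeasure_density)
    finally show "emeasure (distr M borel X) A = emeasure (density lborel (\<lambda>x. ennreal (K * f x))) A" .
  qed simp
  then have "distributed M lborel X (normalized_density f)"
    by (intro distributed_normalized_density[where C = K]) (auto simp: f0 K_def)
  moreover have "f = (\<lambda>x. x powr (a - 1) * exp (- c * x) / (1 + x) powr (a + (b - a)) * indicator {0<..} x)"
    by (auto simp: f_def gamma_kernel_def powr_minus field_simps)
  ultimately show ?thesis
    by (simp add: kummer_density_def)
qed

section \<open>Pascal recurrences and mixed tilted moments\<close>

text \<open>Multiplying the recurrence of \<open>K\<close> by \<open>h (i + 1)\<close> and trading
  \<open>K\<close> for \<open>F\<close> through the product identity gives the relation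
  \<open>HF\<close>, in terms of \<open>F\<close> alone. Three neighbouring instances of it and the
  recurrence of \<open>F\<close> eliminate all values but \<open>F (i + 1) (j + 1)\<close>. As
  \<open>i\<close> and \<open>j\<close> vary independently, all increments on both sides equal one
  constant.\<close>

lemma pascal_product_increments:
  fixes F K :: "nat \<Rightarrow> nat \<Rightarrow> real" and g h :: "nat \<Rightarrow> real"
  assumes F: "\<And>i j. 0 < F i j" and g: "\<And>j. 0 < g j" and h: "\<And>i. 0 < h i"
    and F_rec: "\<And>i j. F i j = F i (Suc j) + F (Suc i) (Suc j)"
    and K_rec: "\<And>j i. K j i = K j (Suc i) + K (Suc j) (Suc i)"
    and prod: "\<And>i j. F i j * g j = h i * K j i"
  shows "g (j + 2) / g (j + 1) - g (j + 1) / g j = h (i + 2) / h (i + 1) - h (i + 1) / h i"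
proof -
  define G where "G j = g (Suc j) / g j" for j
  define H where "H i = h (Suc i) / h i" for i
  have HF: "H i * F i j = F (Suc i) j + G j * F (Suc i) (Suc j)" for i j
  proof -
    have "h (Suc i) * K j i = F (Suc i) j * g j + F (Suc i) (Suc j) * g (Suc j)"
      by (subst K_rec) (simp add: prod distrib_left)
    then have "h (Suc i) * F i j * g j = h i * (F (Suc i) j * g j + F (Suc i) (Suc j) * g (Suc j))"
      using prod[of i j] by algebra
    then have "h (Suc i) * F i j = h i * (F (Suc i) j * g j + F (Suc i) (Suc j) * g (Suc j)) / g j"
      using g[of j] by (simp add: eq_divide_eq)
    then show ?thesis
      using g[of j] h[of i] by (simp add: G_def H_def add_divide_distrib distrib_left eq_divide_eq divide_eq_eq)
  qed
  have "(H (Suc i) - H i) * F (Suc i) (Suc j) = (G (Suc j) - G j) * F (Suc i) (Suc j)"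
    using HF[of i j] HF[of i "Suc j"] HF[of "Suc i" "Suc j"]
      F_rec[of i j] F_rec[of i "Suc j"] F_rec[of "Suc i" j] F_rec[of "Suc i" "Suc j"]
    by algebra
  then have "H (Suc i) - H i = G (Suc j) - G j"
    using F[of "Suc i" "Suc j"] by simp
  then show ?thesis by (simp add: G_def H_def)
qed

text \<open>The powers of \<open>1 + Z\<close> are in the denominator because for
  \<open>Y = U * (1 + X)\<close> and \<open>V = X * (1 + U)\<close> both
  \<open>X^i / (1 + X)^j * Y^j\<close> and \<open>U^j / (1 + U)^i * V^i\<close> equal
  \<open>X^i * U^j\<close>.\<close>

definition mixed_lap :: "'w measure \<Rightarrow> ('w \<Rightarrow> real) \<Rightarrow> real \<Rightarrow> nat \<Rightarrow> nat \<Rightarrow> real" where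
  "mixed_lap M Z g i j = (LINT \<omega>|M. Z \<omega> ^ i / (1 + Z \<omega>) ^ j * exp (- g * Z \<omega>))"

context prob_space
begin

lemma mixed_lap_integrable:
  assumes Z[measurable]: "Z \<in> borel_measurable M" and pos: "\<And>\<omega>. 0 < Z \<omega>" and g: "0 < (g::real)"
  shows "integrable M (\<lambda>\<omega>. Z \<omega> ^ i / (1 + Z \<omega>) ^ j * exp (- g * Z \<omega>))"
proof (rule Bochner_Integration.integrable_bound[OF integrable_power_exp[OF Z pos g, of i]])
  show "AE \<omega> in M. norm (Z \<omega> ^ i / (1 + Z \<omega>) ^ j * exp (- g * Z \<omega>)) \<le> norm (Z \<omega> ^ i * exp (- g * Z \<omega>))"
  proof (rule AE_I2)
    fix \<omega>
    have z: "0 < Z \<omega>" by (rule pos)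
    then have "Z \<omega> ^ i / (1 + Z \<omega>) ^ j \<le> Z \<omega> ^ i / 1"
      by (intro divide_left_mono) (auto intro: one_le_power)
    then show "norm (Z \<omega> ^ i / (1 + Z \<omega>) ^ j * exp (- g * Z \<omega>)) \<le> norm (Z \<omega> ^ i * exp (- g * Z \<omega>))"
      using z mult_right_mono[of "Z \<omega> ^ i / (1 + Z \<omega>) ^ j" "Z \<omega> ^ i" "exp (- g * Z \<omega>)"]
      by (simp add: abs_mult)
  qed
qed simp

lemma mixed_lap_pos:
  assumes "Z \<in> borel_measurable M" "\<And>\<omega>. 0 < Z \<omega>" "0 < (g::real)"
  shows "0 < mixed_lap M Z g i j"
  unfolding mixed_lap_def
  by (intro integral_pos_real mixed_lap_integrable mult_pos_pos divide_pos_pos zero_less_power)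
    (use assms in \<open>auto simp: add_pos_pos\<close>)

text \<open>The integrand is split by the factor \<open>1 = (1 + z) / (1 + z)\<close>.\<close>

lemma mixed_lap_rec:
  assumes "Z \<in> borel_measurable M" "\<And>\<omega>. 0 < Z \<omega>" "0 < (g::real)"
  shows "mixed_lap M Z g i j = mixed_lap M Z g i (Suc j) + mixed_lap M Z g (Suc i) (Suc j)"
  unfolding mixed_lap_def
proof (subst Bochner_Integration.integral_add[symmetric])
  have "z ^ i / (1 + z) ^ j * exp (- g * z) = z ^ i / (1 + z) ^ Suc j * exp (- g * z)
      + z ^ Suc i / (1 + z) ^ Suc j * exp (- g * z)" if "0 < z" for z :: real
  proof -
    have "z ^ i / (1 + z) ^ Suc j + z ^ Suc i / (1 + z) ^ Suc j = z ^ i * (1 + z) / ((1 + z) * (1 + z) ^ j)"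
      by (simp add: add_divide_distrib[symmetric] algebra_simps)
    also have "\<dots> = z ^ i / (1 + z) ^ j"
      using that by simp
    finally show ?thesis by (simp only: distrib_right[symmetric])
  qed
  then show "(LINT \<omega>|M. Z \<omega> ^ i / (1 + Z \<omega>) ^ j * exp (- g * Z \<omega>)) =
      (LINT \<omega>|M. Z \<omega> ^ i / (1 + Z \<omega>) ^ Suc j * exp (- g * Z \<omega>)
        + Z \<omega> ^ Suc i / (1 + Z \<omega>) ^ Suc j * exp (- g * Z \<omega>))"
    using assms(2) by (intro Bochner_Integration.integral_cong) auto
qed (intro mixed_lap_integrable assms)+

text \<open>For the normalized tilted law \<open>m\<close> is the mean, and the first increment of
  the moment ratios is the variance divided by the mean.\<close>

lemma lap_variance:
  assumes Y: "Y \<in> borel_measurable M" and pos: "\<And>\<omega>. 0 < Y \<omega>" and g: "0 < (g::real)"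
  defines "m \<equiv> lap M Y 1 g / lap M Y 0 g"
  shows "lap M Y 2 g / lap M Y 1 g - lap M Y 1 g / lap M Y 0 g
    = (LINT \<omega>|M. (Y \<omega> - m)\<^sup>2 * exp (- g * Y \<omega>)) / lap M Y 1 g"
    and "integrable M (\<lambda>\<omega>. (Y \<omega> - m)\<^sup>2 * exp (- g * Y \<omega>))"
proof -
  note int = integrable_power_exp[OF Y pos g]
  have e: "(Y \<omega> - m)\<^sup>2 * exp (- g * Y \<omega>) = Y \<omega> ^ 2 * exp (- g * Y \<omega>)
      - 2 * m * (Y \<omega> ^ 1 * exp (- g * Y \<omega>)) + m\<^sup>2 * (Y \<omega> ^ 0 * exp (- g * Y \<omega>))" for \<omega>
    by (simp add: power2_eq_square algebra_simps)
  show "integrable M (\<lambda>\<omega>. (Y \<omega> - m)\<^sup>2 * exp (- g * Y \<omega>))"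
    unfolding e by (intro Bochner_Integration.integrable_add Bochner_Integration.integrable_diff integrable_mult_right int)
  define I where "I = (LINT \<omega>|M. (Y \<omega> - m)\<^sup>2 * exp (- g * Y \<omega>))"
  have I: "I = lap M Y 2 g - 2 * m * lap M Y 1 g + m\<^sup>2 * lap M Y 0 g"
    unfolding I_def e lap_def
    by (subst Bochner_Integration.integral_add Bochner_Integration.integral_diff integral_mult_right_zero;
        (intro Bochner_Integration.integrable_add Bochner_Integration.integrable_diff integrable_mult_right int)?)+ (rule refl)
  have "lap M Y 2 g / lap M Y 1 g - lap M Y 1 g / lap M Y 0 g = I / lap M Y 1 g"
  proof -
    have L: "0 < lap M Y 0 g" "0 < lap M Y 1 g"
      by (rule lap_pos[OF Y pos g])+
    then have "lap M Y 2 g * lap M Y 0 g - lap M Y 1 g * lap M Y 1 g = I * lap M Y 0 g"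
      using I L by (simp add: m_def field_simps power2_eq_square)
    moreover have "lap M Y 2 g / lap M Y 1 g - lap M Y 1 g / lap M Y 0 g
        = (lap M Y 2 g * lap M Y 0 g - lap M Y 1 g * lap M Y 1 g) / (lap M Y 1 g * lap M Y 0 g)"
      using L by (simp add: diff_frac_eq)
    ultimately show ?thesis using L by simp
  qed
  then show "lap M Y 2 g / lap M Y 1 g - lap M Y 1 g / lap M Y 0 g
    = (LINT \<omega>|M. (Y \<omega> - m)\<^sup>2 * exp (- g * Y \<omega>)) / lap M Y 1 g"
    by (simp add: I_def)
qed

text \<open>The tilting weight is strictly positive, so the tilted variance vanishes exactly when
  \<open>Y\<close> is almost surely constant.\<close>

lemma lap_increment_zero_iff:
  assumes Y: "Y \<in> borel_measurable M" and pos: "\<And>\<omega>. 0 < Y \<omega>" and g: "0 < (g::real)"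
  shows "0 \<le> lap M Y 2 g / lap M Y 1 g - lap M Y 1 g / lap M Y 0 g"
    and "lap M Y 2 g / lap M Y 1 g - lap M Y 1 g / lap M Y 0 g = 0 \<longleftrightarrow> \<not> nondegenerate M Y"
proof -
  note L = lap_pos[OF Y pos g]
  note var = lap_variance[OF Y pos g]
  let ?m = "lap M Y 1 g / lap M Y 0 g"
  let ?I = "LINT \<omega>|M. (Y \<omega> - ?m)\<^sup>2 * exp (- g * Y \<omega>)"
  show "0 \<le> lap M Y 2 g / lap M Y 1 g - lap M Y 1 g / lap M Y 0 g"
    unfolding var(1) by (intro divide_nonneg_pos integral_nonneg_AE L) simp
  show "lap M Y 2 g / lap M Y 1 g - lap M Y 1 g / lap M Y 0 g = 0 \<longleftrightarrow> \<not> nondegenerate M Y"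
  proof
    assume "lap M Y 2 g / lap M Y 1 g - lap M Y 1 g / lap M Y 0 g = 0"
    then have "?I = 0"
      unfolding var(1) using L[of 1] by simp
    then have "AE \<omega> in M. Y \<omega> = ?m"
      by (subst (asm) integral_nonneg_eq_0_iff_AE[OF var(2)]) auto
    then show "\<not> nondegenerate M Y" by (auto simp: nondegenerate_def)
  next
    assume "\<not> nondegenerate M Y"
    then obtain k where k: "AE \<omega> in M. Y \<omega> = k" by (auto simp: nondegenerate_def)
    have "lap M Y n g = k ^ n * exp (- g * k)" for n
    proof -
      have "lap M Y n g = (LINT \<omega>|M. k ^ n * exp (- g * k))"
        unfolding lap_def by (rule integral_cong_AE) (use Y k in \<open>auto elim!: eventually_mono\<close>)
      then show ?thesis by (simp add: prob_space)
    qed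
    then show "lap M Y 2 g / lap M Y 1 g - lap M Y 1 g / lap M Y 0 g = 0"
      by (simp add: power2_eq_square)
  qed
qed

end

section \<open>Independence of \<open>(X, Y)\<close> and of \<open>(U, V)\<close> characterizes
  Kummer and gamma laws\<close>

context prob_space
begin

context
  fixes X Y U V :: "'a \<Rightarrow> real"
  assumes XY: "indep_var borel X borel Y" and UV: "indep_var borel U borel V"
    and X_pos: "\<And>\<omega>. 0 < X \<omega>" and U_pos: "\<And>\<omega>. 0 < U \<omega>"
    and Y_eq: "\<And>\<omega>. Y \<omega> = U \<omega> * (1 + X \<omega>)" and V_eq: "\<And>\<omega>. V \<omega> = X \<omega> * (1 + U \<omega>)"
begin

lemma measurable_XYUV [measurable]:
  "X \<in> borel_measurable M" "Y \<in> borel_measurable M" "U \<in> borel_measurable M" "V \<in> borel_measurable M"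
  using XY UV by (auto simp: indep_var_distribution_eq)

lemma YV_pos: "0 < Y \<omega>" "0 < V \<omega>"
  using X_pos[of \<omega>] U_pos[of \<omega>] by (simp_all add: Y_eq V_eq)

text \<open>Since \<open>X + Y = U + V\<close>, exponential tilting preserves both independences.\<close>

lemma mixed_lap_product:
  assumes g: "0 < g"
  shows "mixed_lap M X g i j * lap M Y j g = lap M V i g * mixed_lap M U g j i"
proof -
  have p1: "(LINT \<omega>|M. (X \<omega> ^ i / (1 + X \<omega>) ^ j * exp (- g * X \<omega>)) * (Y \<omega> ^ j * exp (- g * Y \<omega>)))
      = mixed_lap M X g i j * lap M Y j g"
    unfolding mixed_lap_def lap_def
    by (intro indep_var_lebesgue_integral mixed_lap_integrable integrable_power_exp
        indep_var_compose[OF XY, of "\<lambda>x. x ^ i / (1 + x) ^ j * exp (- g * x)" borel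
          "\<lambda>y. y ^ j * exp (- g * y)" borel, unfolded comp_def] X_pos YV_pos g) simp_all
  have p2: "(LINT \<omega>|M. (U \<omega> ^ j / (1 + U \<omega>) ^ i * exp (- g * U \<omega>)) * (V \<omega> ^ i * exp (- g * V \<omega>)))
      = mixed_lap M U g j i * lap M V i g"
    unfolding mixed_lap_def lap_def
    by (intro indep_var_lebesgue_integral mixed_lap_integrable integrable_power_exp
        indep_var_compose[OF UV, of "\<lambda>x. x ^ j / (1 + x) ^ i * exp (- g * x)" borel
          "\<lambda>y. y ^ i * exp (- g * y)" borel, unfolded comp_def] U_pos YV_pos g) simp_all
  have p3: "(X \<omega> ^ i / (1 + X \<omega>) ^ j * exp (- g * X \<omega>)) * (Y \<omega> ^ j * exp (- g * Y \<omega>))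
      = (U \<omega> ^ j / (1 + U \<omega>) ^ i * exp (- g * U \<omega>)) * (V \<omega> ^ i * exp (- g * V \<omega>))" for \<omega>
  proof -
    have "(X \<omega> ^ i / (1 + X \<omega>) ^ j) * Y \<omega> ^ j = (U \<omega> ^ j / (1 + U \<omega>) ^ i) * V \<omega> ^ i"
      using X_pos[of \<omega>] U_pos[of \<omega>] by (simp add: Y_eq V_eq power_mult_distrib)
    moreover have "exp (- g * X \<omega>) * exp (- g * Y \<omega>) = exp (- g * U \<omega>) * exp (- g * V \<omega>)"
      by (simp add: exp_add[symmetric] Y_eq V_eq algebra_simps)
    moreover have interchange: "(p * q) * (r * s) = (p * r) * (q * s)" for p q r s :: real
      by (simp only: ac_simps)
    ultimately show ?thesis
      unfolding interchange[of _ "exp _"] by (simp only:)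
  qed
  show ?thesis
    using trans[OF p1[symmetric, unfolded p3] p2] by (simp only: mult.commute)
qed

lemma lap_increments:
  assumes g: "0 < g"
  shows "lap M Y (j + 2) g / lap M Y (j + 1) g - lap M Y (j + 1) g / lap M Y j g
    = lap M V (i + 2) g / lap M V (i + 1) g - lap M V (i + 1) g / lap M V i g"
  by (rule pascal_product_increments[where F = "mixed_lap M X g" and K = "mixed_lap M U g"
        and g = "\<lambda>n. lap M Y n g" and h = "\<lambda>n. lap M V n g"])
    (intro mixed_lap_pos lap_pos mixed_lap_rec mixed_lap_product measurable_XYUV X_pos U_pos YV_pos g)+

text \<open>Degeneracy is the vanishing of the first increment, and the first increments of
  \<open>Y\<close> and \<open>V\<close> coincide. One tilt, \<open>g = 1\<close>, is enough.\<close>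

lemma nondegenerate_V_iff: "nondegenerate M V \<longleftrightarrow> nondegenerate M Y"
proof -
  have eq: "lap M Y 2 1 / lap M Y 1 1 - lap M Y 1 1 / lap M Y 0 1
      = lap M V 2 1 / lap M V 1 1 - lap M V 1 1 / lap M V 0 1"
    using lap_increments[of 1 0 0] by (simp add: numeral_2_eq_2)
  show ?thesis
    using lap_increment_zero_iff(2)[OF measurable_XYUV(2) YV_pos(1) zero_less_one]
      lap_increment_zero_iff(2)[OF measurable_XYUV(4) YV_pos(2) zero_less_one]
    unfolding eq by blast
qed

text \<open>If \<open>Y\<close> is constant, so is \<open>V\<close>, and
  \<open>X + Y = U + V\<close> expresses \<open>U\<close> through \<open>X\<close>. Then
  \<open>X\<close> solves a fixed quadratic equation whose roots have the negative product
  \<open>- v\<close>, so it has only one positive value.\<close>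

lemma nondegenerate_Y:
  assumes "nondegenerate M X"
  shows "nondegenerate M Y"
proof (rule ccontr)
  assume Y: "\<not> nondegenerate M Y"
  then have "\<not> nondegenerate M V" by (simp add: nondegenerate_V_iff)
  with Y obtain y v where yv: "AE \<omega> in M. Y \<omega> = y" "AE \<omega> in M. V \<omega> = v"
    by (auto simp: nondegenerate_def)
  have root: "AE \<omega> in M. X \<omega> * (1 + X \<omega> + y - v) = v"
    using yv
  proof eventually_elim
    fix \<omega> assume "Y \<omega> = y" "V \<omega> = v"
    then have "1 + X \<omega> + y - v = 1 + U \<omega>" "X \<omega> * (1 + U \<omega>) = v"
      by (auto simp: Y_eq V_eq algebra_simps)
    then show "X \<omega> * (1 + X \<omega> + y - v) = v" by (simp only:)
  qed
  then have "AE \<omega> in M. X \<omega> * (1 + X \<omega> + y - v) = v \<and> V \<omega> = v"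
    using yv(2) by eventually_elim simp
  then obtain \<omega>0 where w0: "X \<omega>0 * (1 + X \<omega>0 + y - v) = v" "V \<omega>0 = v"
    using eventually_happens'[OF ae_filter_bot] by blast
  have v: "0 < v" using YV_pos(2)[of \<omega>0] w0 by simp
  have "AE \<omega> in M. X \<omega> = X \<omega>0"
    using root
  proof eventually_elim
    fix \<omega> assume w: "X \<omega> * (1 + X \<omega> + y - v) = v"
    \<comment> \<open>Cross-multiplying the equations of two roots exhibits their difference as a
      factor; the cofactor is positive for positive roots.\<close>
    have "(X \<omega> - X \<omega>0) * (X \<omega> * X \<omega>0 + v) =
        X \<omega>0 * (X \<omega> * (1 + X \<omega> + y - v)) - X \<omega> * (X \<omega>0 * (1 + X \<omega>0 + y - v)) + (X \<omega> - X \<omega>0) * v"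
      by (simp add: algebra_simps)
    also have "\<dots> = 0"
      unfolding w w0(1) by (simp add: algebra_simps)
    finally have "(X \<omega> - X \<omega>0) * (X \<omega> * X \<omega>0 + v) = 0" .
    moreover have "0 < X \<omega> * X \<omega>0 + v"
      using X_pos v by (simp add: add_pos_pos)
    ultimately show "X \<omega> = X \<omega>0" by simp
  qed
  with assms show False by (auto simp: nondegenerate_def)
qed

text \<open>All increments of the moment ratios of \<open>Y\<close> and of \<open>V\<close> equal
  the same \<open>k\<close>. The shapes \<open>b\<close> and \<open>a\<close> may differ, but both
  rates satisfy \<open>k g * (g + c) = 1\<close>, so they agree.\<close>

theorem kummer_gamma_characterization:
  assumes "nondegenerate M Y"
  obtains a b c where "0 < a" "0 < b" "0 < c" "gamma_ratio M Y b c" "gamma_ratio M V a c"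
    "distributed M lborel X (kummer_density a (b - a) c)"
proof -
  define k where "k g = lap M Y 2 g / lap M Y 1 g - lap M Y 1 g / lap M Y 0 g" for g
  have k: "lap M Y 3 g / lap M Y 2 g - lap M Y 2 g / lap M Y 1 g = k g"
    "lap M V 2 g / lap M V 1 g - lap M V 1 g / lap M V 0 g = k g"
    "lap M V 3 g / lap M V 2 g - lap M V 2 g / lap M V 1 g = k g" if g: "0 < g" for g
    using lap_increments[OF g, of 0 0] lap_increments[OF g, of 0 1] lap_increments[OF g, of 1 0]
    by (simp_all add: k_def numeral_2_eq_2 numeral_3_eq_3)
  have k_pos: "0 < k g" if "0 < g" for g
    using lap_increment_zero_iff[OF measurable_XYUV(2) YV_pos(1) that] assms
    by (simp add: k_def order_less_le)
  obtain b c where bc: "0 < b" "\<And>g. 0 < g \<Longrightarrow> k g * (g + c) = 1" "gamma_ratio M Y b c"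
    by (rule gamma_ratio_of_constant_increments[OF measurable_XYUV(2) YV_pos(1) k_def[symmetric] k(1) k_pos])
      (assumption | (rule that; assumption))+
  obtain a c' where ac: "0 < a" "\<And>g. 0 < g \<Longrightarrow> k g * (g + c') = 1" "gamma_ratio M V a c'"
    by (rule gamma_ratio_of_constant_increments[OF measurable_XYUV(4) YV_pos(2) k(2,3) k_pos])
      (assumption | (rule that; assumption))+
  have "k 1 * (1 + c) = k 1 * (1 + c')"
    using bc(2)[of 1] ac(2)[of 1] by simp
  then have [simp]: "c' = c" using k_pos[of 1] by simp
  have gc: "0 < g + c" if "0 < g" for g
    using bc(2)[OF that] k_pos[OF that] by (metis zero_less_mult_pos zero_less_one)
  have c: "0 < c"
    by (rule gamma_ratio_laplace(1)[OF measurable_XYUV(2) YV_pos(1) bc(3,1) gc])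
  note gY = gamma_ratio_distributed(1)[OF measurable_XYUV(2) YV_pos(1) bc(3,1) c]
  note gV = gamma_ratio_distributed(1)[OF measurable_XYUV(4) YV_pos(2) ac(3)[simplified] ac(1) c]
  have "distributed M lborel X (kummer_density a (b - a) c)"
    by (rule kummer_distributed[OF XY UV X_pos U_pos Y_eq V_eq gY _ gV _ ac(1) bc(1) c])
      (use c in \<open>auto intro!: divide_pos_pos Gamma_real_pos bc(1) ac(1)\<close>)
  then show ?thesis
    using that[OF ac(1) bc(1) c bc(3)] ac(3) by simp
qed

end

end

section \<open>Re-rooting trees\<close>

lemma edge_commute: "{u, v} \<in> E \<Longrightarrow> {v, u} \<in> E"
  by (simp add: insert_commute)

lemma children_edge: "k \<in> children V E r i \<Longrightarrow> {i, k} \<in> E"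
  by (simp add: children_def)

context
  fixes V :: "'v set" and E :: "'v set set"
  assumes T: "is_tree V E"
begin

lemma tree_simple: "simple_graph V E" and tree_connected: "graph_connected V E"
  and tree_acyclic: "\<not> graph_cycle V E xs"
  using T by (auto simp: is_tree_def)

lemma edge_vertices:
  assumes "{u, v} \<in> E"
  shows "u \<in> V" "v \<in> V" "u \<noteq> v"
proof -
  obtain a b where "a \<in> V" "b \<in> V" "a \<noteq> b" "{u, v} = {a, b}"
    using assms tree_simple unfolding simple_graph_def by blast
  then show "u \<in> V" "v \<in> V" "u \<noteq> v"
    by (auto simp: doubleton_eq_iff)
qed

lemma graph_dist_self: "u \<in> V \<Longrightarrow> graph_dist V E u u = 0"
  using graph_dist_le[of V E "[u]"] by (simp add: walk_def)

lemma graph_dist_step: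
  assumes r: "r \<in> V" and e: "{u, v} \<in> E"
  shows "graph_dist V E r v \<le> Suc (graph_dist V E r u)"
proof -
  obtain xs where xs: "walk V E xs" "hd xs = r" "last xs = u" "length xs = Suc (graph_dist V E r u)"
    using graph_dist_attained[OF tree_connected r edge_vertices(1)[OF e]] by blast
  then have "walk V E (xs @ [v])"
    using e edge_vertices(2)[OF e] by (auto simp: walk_def successively_append_iff)
  from graph_dist_le[OF this] show ?thesis
    using xs by (auto simp: walk_def)
qed

lemma graph_dist_commute:
  assumes "u \<in> V" "v \<in> V"
  shows "graph_dist V E u v = graph_dist V E v u"
proof -
  have "graph_dist V E v u \<le> graph_dist V E u v" if uv: "u \<in> V" "v \<in> V" for u v
  proof -
    obtain xs where xs: "walk V E xs" "hd xs = u" "last xs = v" "length xs = Suc (graph_dist V E u v)"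
      using graph_dist_attained[OF tree_connected uv] by blast
    then have "walk V E (rev xs)"
      by (auto simp: walk_def successively_rev insert_commute)
    from graph_dist_le[OF this] show ?thesis
      using xs by (simp add: hd_rev last_rev)
  qed
  then show ?thesis using assms by (meson antisym)
qed

lemma graph_dist_eq_0_iff:
  assumes "u \<in> V" "v \<in> V"
  shows "graph_dist V E u v = 0 \<longleftrightarrow> v = u"
proof
  assume "graph_dist V E u v = 0"
  then have "v \<notin> children V E u j" for j
    by (simp add: children_def)
  then show "v = u"
    using ex_parent[OF tree_connected assms] by blast
qed (simp add: graph_dist_self assms)

lemma graph_dist_edge:
  assumes "{u, v} \<in> E"
  shows "graph_dist V E u v = 1"
  using graph_dist_step[OF edge_vertices(1)[OF assms] assms] edge_vertices[OF assms]
    graph_dist_eq_0_iff[of u v] graph_dist_self[of u] by fastforce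

text \<open>Two adjacent vertices at equal distance from \<open>r\<close> would close a cycle
  through a path joining their parents. That path stays closer to \<open>r\<close> and so avoids
  both; it is a single vertex when the parents coincide.\<close>

lemma edge_dist_neq:
  assumes r: "r \<in> V" and e: "{j, k} \<in> E"
  shows "graph_dist V E r j \<noteq> graph_dist V E r k"
proof
  assume eq: "graph_dist V E r j = graph_dist V E r k"
  note jk = edge_vertices[OF e]
  have "j \<noteq> r" "k \<noteq> r"
    using eq jk r graph_dist_eq_0_iff[OF r] by metis+
  then obtain j' k' where j': "j' \<in> V" "j \<in> children V E r j'"
      and k': "k' \<in> V" "k \<in> children V E r k'"
    using ex_parent[OF tree_connected r] jk by metis
  let ?d = "graph_dist V E r j'"
  have d: "graph_dist V E r j = Suc ?d" "graph_dist V E r k = Suc ?d" "graph_dist V E r k' = ?d"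
  proof -
    have "graph_dist V E r j = Suc (graph_dist V E r j')" "graph_dist V E r k = Suc (graph_dist V E r k')"
      using j'(2) k'(2) by (simp_all add: children_def)
    then show "graph_dist V E r j = Suc ?d" "graph_dist V E r k = Suc ?d" "graph_dist V E r k' = ?d"
      using eq by linarith+
  qed
  obtain xs where xs: "walk V E xs" "distinct xs" "hd xs = j'" "last xs = k'"
      "\<forall>x\<in>set xs. graph_dist V E r x \<le> ?d"
  proof (cases "j' = k'")
    case True
    then show thesis
      using that[of "[j']"] j'(1) by (simp add: walk_def)
  next
    case False
    then show thesis
      using path_same_dist[OF tree_connected r j'(1) k'(1) False refl d(3)] that by blast
  qed
  have ne: "xs \<noteq> []"
    using xs(1) by (simp add: walk_def)
  have "walk V E (j # xs @ [k])"
    using xs ne jk j' k'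
    by (auto simp: walk_def successively_append_iff successively_Cons children_def insert_commute)
  moreover have "distinct (j # xs @ [k])"
    using xs jk d by fastforce
  ultimately have "graph_cycle V E (j # xs @ [k])"
    using ne edge_commute[OF e] by (cases xs) (auto simp: graph_cycle_def)
  then show False using tree_acyclic by blast
qed

lemma children_root:
  assumes "r \<in> V"
  shows "children V E r r = {l. {r, l} \<in> E}"
  using graph_dist_edge graph_dist_self assms by (auto simp: children_def)

text \<open>A neighbour other than the unique parent is not closer to \<open>r\<close> and cannot be
  equally far, so it is a child. The root enters the right-hand side only through the parent
  \<open>i\<close>.\<close>

lemma children_nonroot:
  assumes r: "r \<in> V" and k: "k \<in> children V E r i"
  shows "children V E r k = {l. {k, l} \<in> E} - {i}"
proof (rule set_eqI)
  fix l
  have ik: "{i, k} \<in> E" "graph_dist V E r k = Suc (graph_dist V E r i)"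
    using k by (auto simp: children_def)
  note V = edge_vertices[OF ik(1)]
  have kr: "k \<noteq> r"
    using ik(2) graph_dist_self[OF r] by auto
  show "l \<in> children V E r k \<longleftrightarrow> l \<in> {l. {k, l} \<in> E} - {i}"
  proof
    assume "l \<in> children V E r k"
    then show "l \<in> {l. {k, l} \<in> E} - {i}"
      using ik by (auto simp: children_def)
  next
    assume "l \<in> {l. {k, l} \<in> E} - {i}"
    then have l: "{k, l} \<in> E" "l \<noteq> i" by auto
    have "k \<notin> children V E r l"
      using ex1_parent[OF T r V(2) kr] k l(2) by blast
    then have "graph_dist V E r k \<noteq> Suc (graph_dist V E r l)"
      using edge_commute[OF l(1)] by (simp add: children_def)
    moreover have "graph_dist V E r k \<le> Suc (graph_dist V E r l)"
      by (rule graph_dist_step[OF r edge_commute[OF l(1)]])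
    moreover have "graph_dist V E r l \<le> Suc (graph_dist V E r k)"
      by (rule graph_dist_step[OF r l(1)])
    ultimately have "graph_dist V E r l = Suc (graph_dist V E r k)"
      using edge_dist_neq[OF r l(1)] by linarith
    with l(1) show "l \<in> children V E r k" by (simp add: children_def)
  qed
qed

lemma finite_children: "finite (children V E r i)"
proof (rule finite_subset)
  show "children V E r i \<subseteq> V"
    using edge_vertices by (auto simp: children_def)
  show "finite V" using tree_simple by (simp add: simple_graph_def)
qed

section \<open>The transformation under a change of root\<close>

text \<open>The component at \<open>k\<close> depends only on the subtree below \<open>k\<close>,
  which is the same for all roots that give \<open>k\<close> the parent \<open>i\<close>.\<close>

lemma Phi_change_root:
  assumes r: "r \<in> V" and r': "r' \<in> V"
    and k: "k \<in> children V E r i" and k': "k \<in> children V E r' i"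
  shows "Phi V E C r s k = Phi V E C r' s k"
  using k k'
proof (induction k arbitrary: i rule: wf_induct_rule[OF wf_children[OF tree_simple, of r]])
  case (1 k)
  have c: "children V E r k = children V E r' k"
    using children_nonroot[OF r 1(2)] children_nonroot[OF r' 1(3)] by simp
  have "(\<Prod>j\<in>children V E r k. 1 + C k j / C k k * Phi V E C r s j) =
        (\<Prod>j\<in>children V E r' k. 1 + C k j / C k k * Phi V E C r' s j)"
    by (rule prod.cong[OF c]) (use 1(1) c in auto)
  then show ?case
    by (subst (1 2) Phi_rec[OF tree_simple]) simp
qed

lemma child_at_neighbour: "{i, k} \<in> E \<Longrightarrow> k \<in> children V E i i"
  using children_root edge_vertices by blast

text \<open>Taking the root at \<open>i\<close> instead of \<open>j\<close> adds exactly one child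
  to \<open>i\<close>, namely \<open>j\<close>; the other factors are unchanged.\<close>

lemma Phi_edge:
  assumes e: "{i, j} \<in> E"
  shows "Phi V E C i s i = Phi V E C j s i * (1 + C i j / C i i * Phi V E C i s j)"
proof -
  note V = edge_vertices[OF e]
  have ch: "children V E j i = {l. {i, l} \<in> E} - {j}"
    by (rule children_nonroot[OF V(2) child_at_neighbour[OF edge_commute[OF e]]])
  have jc: "j \<in> children V E i i" by (rule child_at_neighbour[OF e])
  have split: "children V E i i = insert j (children V E j i)"
    unfolding ch children_root[OF V(1)] using e by auto
  have "Phi V E C i s k = Phi V E C j s k" if "k \<in> children V E j i" for k
    by (rule Phi_change_root[OF V(1,2) _ that]) (use that split in auto)
  then have "(\<Prod>k\<in>children V E j i. 1 + C i k / C i i * Phi V E C i s k)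
      = (\<Prod>k\<in>children V E j i. 1 + C i k / C i i * Phi V E C j s k)"
    by (intro prod.cong) auto
  moreover have "j \<notin> children V E j i" using ch by auto
  ultimately have "Phi V E C i s i = s i * ((1 + C i j / C i i * Phi V E C i s j) *
      (\<Prod>k\<in>children V E j i. 1 + C i k / C i i * Phi V E C j s k))"
    by (subst Phi_rec[OF tree_simple], subst split) (simp add: finite_children)
  also have "\<dots> = Phi V E C j s i * (1 + C i j / C i i * Phi V E C i s j)"
    by (subst (2) Phi_rec[OF tree_simple]) simp
  finally show ?thesis .
qed

lemma Phi_pos:
  assumes s: "\<And>i. i \<in> V \<Longrightarrow> 0 < s i" and C: "\<And>i j. {i, j} \<in> E \<Longrightarrow> 0 < C i j"
    and C': "\<And>i. i \<in> V \<Longrightarrow> 0 < C i i" and i: "i \<in> V"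
  shows "0 < (Phi V E C r s i :: real)"
  using i
proof (induction i rule: wf_induct_rule[OF wf_children[OF tree_simple, of r]])
  case (1 i)
  have "0 < 1 + C i j / C i i * Phi V E C r s j" if j: "j \<in> children V E r i" for j
    using 1(1)[of j] j C[OF children_edge[OF j]] C'[OF 1(2)] edge_vertices(2)[OF children_edge[OF j]]
    by (intro add_pos_pos mult_pos_pos divide_pos_pos) auto
  then show ?case
    by (subst Phi_rec[OF tree_simple]) (intro mult_pos_pos prod_pos s 1(2), auto)
qed

lemma Phi_measurable:
  fixes C :: "'v \<Rightarrow> 'v \<Rightarrow> real"
  assumes X: "\<And>i. i \<in> V \<Longrightarrow> X i \<in> borel_measurable M" and i: "i \<in> V"
  shows "(\<lambda>\<omega>. Phi V E C r (\<lambda>j. X j \<omega>) i) \<in> borel_measurable M"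
  using i
proof (induction i rule: wf_induct_rule[OF wf_children[OF tree_simple, of r]])
  case (1 i)
  have "(\<lambda>\<omega>. Phi V E C r (\<lambda>j. X j \<omega>) j) \<in> borel_measurable M" if "j \<in> children V E r i" for j
    using 1(1)[of j] that edge_vertices(2)[OF children_edge[OF that]] by auto
  then show ?case
    by (subst Phi_rec[OF tree_simple]) (intro borel_measurable_times borel_measurable_prod
        borel_measurable_add borel_measurable_const X 1(2))
qed

lemma Phi_cong:
  assumes "\<And>i. i \<in> V \<Longrightarrow> s i = t i" and i: "i \<in> V"
  shows "Phi V E C r s i = Phi V E C r t i"
  using i
proof (induction i rule: wf_induct_rule[OF wf_children[OF tree_simple, of r]])
  case (1 i)
  have "Phi V E C r s j = Phi V E C r t j" if "j \<in> children V E r i" for j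
    using 1(1)[of j] that edge_vertices(2)[OF children_edge[OF that]] by auto
  then show ?case
    using assms(1)[OF 1(2)] by (subst (1 2) Phi_rec[OF tree_simple]) (auto intro: prod.cong)
qed

section \<open>Leaves behind an edge and quantities constant along edges\<close>

text \<open>Independence is assumed for leaf roots only; this supplies, for any orientation of any
  edge, a leaf root inducing it.\<close>

lemma ex_leaf_behind:
  assumes e: "{i, j} \<in> E"
  obtains r where "leaf V E r" "j \<in> children V E r i"
proof -
  note V = edge_vertices[OF e]
  let ?d = "graph_dist V E"
  define S where "S = {v \<in> V. ?d j v = Suc (?d i v)}"
  have fin: "finite S"
    using tree_simple by (auto simp: S_def simple_graph_def)
  have "i \<in> S"
    using V graph_dist_edge[OF edge_commute[OF e]] by (simp add: S_def graph_dist_self)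
  \<comment> \<open>A vertex on the \<open>i\<close>-side of the edge that is farthest from \<open>j\<close> is a leaf.\<close>
  define r where "r = (ARG_MAX (?d j) v. v \<in> S)"
  have r: "r \<in> S" and max: "\<And>v. v \<in> S \<Longrightarrow> ?d j v \<le> ?d j r"
  proof -
    have "is_arg_max (?d j) (\<lambda>v. v \<in> S) r"
    proof -
      have "finite (?d j ` S)" "?d j ` S \<noteq> {}" using fin \<open>i \<in> S\<close> by auto
      then have "Max (?d j ` S) \<in> ?d j ` S" by (rule Max_in)
      then obtain v where v: "v \<in> S" "?d j v = Max (?d j ` S)" by force
      show ?thesis
        unfolding r_def
        by (rule arg_maxI[where x = v]) (use v fin in \<open>auto simp: is_arg_max_def not_less Max_ge\<close>)
    qed
    then show "r \<in> S" "\<And>v. v \<in> S \<Longrightarrow> ?d j v \<le> ?d j r"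
      by (auto simp: is_arg_max_def not_less)
  qed
  then have rV: "r \<in> V" and rd: "?d j r = Suc (?d i r)" by (auto simp: S_def)
  have rj: "r \<noteq> j" using rd graph_dist_self[OF V(2)] by auto
  have "children V E j r = {}"
  proof (rule ccontr)
    assume "children V E j r \<noteq> {}"
    then obtain k where "k \<in> children V E j r" by blast
    then have k: "{r, k} \<in> E" "?d j k = Suc (?d j r)" by (auto simp: children_def)
    note kV = edge_vertices[OF k(1)]
    \<comment> \<open>The two estimates force \<open>?d i k = ?d j r\<close>, so a child
      \<open>k\<close> of \<open>r\<close> would also lie in \<open>S\<close>, yet farther from
      \<open>j\<close> than \<open>r\<close>.\<close>
    have "?d i k \<le> Suc (?d i r)" by (rule graph_dist_step[OF V(1) k(1)])
    moreover have "?d k j \<le> Suc (?d k i)" by (rule graph_dist_step[OF kV(2) e])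
    ultimately have "k \<in> S"
      using k(2) rd kV V by (simp add: S_def graph_dist_commute[of k])
    from max[OF this] k(2) show False by simp
  qed
  moreover obtain p where p: "r \<in> children V E j p"
    using ex1_parent[OF T V(2) rV rj] by blast
  ultimately have nb: "{l. {r, l} \<in> E} \<subseteq> {p}"
    using children_nonroot[OF V(2) p] by blast
  have "{e \<in> E. r \<in> e} = {{r, p}}"
  proof
    show "{e \<in> E. r \<in> e} \<subseteq> {{r, p}}"
    proof
      fix f assume "f \<in> {e \<in> E. r \<in> e}"
      then have f: "f \<in> E" "r \<in> f" by auto
      obtain a b where ab: "f = {a, b}"
        using f(1) tree_simple unfolding simple_graph_def by blast
      then obtain l where "f = {r, l}"
        using f(2) by (auto simp: insert_commute)
      with f(1) nb show "f \<in> {{r, p}}" by auto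
    qed
    show "{{r, p}} \<subseteq> {e \<in> E. r \<in> e}"
      using edge_commute[OF children_edge[OF p]] by auto
  qed
  then have "leaf V E r"
    using rV by (simp add: leaf_def vertex_degree_def)
  moreover have "j \<in> children V E r i"
    using e rd rV V by (simp add: children_def graph_dist_commute[of r])
  ultimately show thesis by (rule that)
qed

text \<open>Induction along a connecting walk. The type of \<open>f\<close> is arbitrary: it is used
  for a truth value (nondegeneracy) and for a real number (the common rate).\<close>

lemma edge_preserved_constant:
  assumes "\<And>i j. {i, j} \<in> E \<Longrightarrow> f i = f j" "u \<in> V" "v \<in> V"
  shows "f u = f v"
proof -
  obtain xs where xs: "walk V E xs" "hd xs = u" "last xs = v"
    using tree_connected assms(2,3) unfolding graph_connected_def by blast
  have "f (hd xs) = f (last xs)" if "successively (\<lambda>u v. {u, v} \<in> E) xs" "xs \<noteq> []" for xs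
    using that
  proof (induction xs rule: induct_list012)
    case (3 x y zs)
    have "f x = f y" by (rule assms(1)) (use 3 in simp)
    also have "\<dots> = f (last (y # zs))" using 3 by simp
    finally show ?case by simp
  qed simp_all
  from this[of xs] xs show ?thesis by (simp add: walk_def)
qed

end

section \<open>Laws along the edges of a tree\<close>

lemma lap_scale: "lap M (\<lambda>\<omega>. k * Y \<omega>) n g = k ^ n * lap M Y n (k * g)"
  by (simp add: lap_def power_mult_distrib mult.assoc mult.left_commute)

lemma gamma_ratio_scale:
  assumes "gamma_ratio M (\<lambda>\<omega>. k * Y \<omega>) b c" "0 < k"
  shows "gamma_ratio M Y b (k * c)"
  unfolding gamma_ratio_def
proof (intro allI impI)
  fix g :: real assume "0 < g"
  then have "0 < g / k" using assms(2) by simp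
  then have "k * lap M Y 1 g * (g / k + c) = b * lap M Y 0 g"
    using assms unfolding gamma_ratio_def lap_scale by fastforce
  then show "lap M Y 1 g * (g + k * c) = b * lap M Y 0 g"
    using assms(2) by (simp add: algebra_simps)
qed

text \<open>The moment ratio \<open>q g\<close> is \<open>b / (g + c)\<close>, which is not constant
  in \<open>g\<close>; two of its values determine both parameters.\<close>

lemma (in prob_space) gamma_ratio_unique:
  assumes Y: "Y \<in> borel_measurable M" "\<And>\<omega>. 0 < Y \<omega>"
    and "gamma_ratio M Y b c" "gamma_ratio M Y b' c'"
  shows "b = b' \<and> c = c'"
proof -
  define q where "q g = lap M Y 1 g / lap M Y 0 g" for g
  have q: "0 < q g" "q g * (g + c) = b" "q g * (g + c') = b'" if "0 < g" for g
    using lap_pos[OF Y that, of 0] lap_pos[OF Y that, of 1] assms(3,4) that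
    by (auto simp: q_def gamma_ratio_def)
  have "q 1 * (c - c') = b - b'" "q 2 * (c - c') = b - b'"
    using q(2,3)[of 1] q(2,3)[of 2] by (simp_all add: algebra_simps)
  moreover have "q 1 \<noteq> q 2"
    using q(2)[of 1] q(2)[of 2] q(1)[of 1] by (auto simp: algebra_simps)
  ultimately have "c = c'"
    by (metis eq_iff_diff_eq_0 mult_cancel_right)
  then show ?thesis using q(2,3)[of 1] by simp
qed

lemma nondegenerate_scale:
  assumes "k \<noteq> 0"
  shows "nondegenerate M (\<lambda>\<omega>. k * Y \<omega>) \<longleftrightarrow> nondegenerate M Y"
proof -
  have "(\<exists>l. AE \<omega> in M. k * Y \<omega> = l) \<longleftrightarrow> (\<exists>l. AE \<omega> in M. Y \<omega> = l)"
  proof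
    assume "\<exists>l. AE \<omega> in M. k * Y \<omega> = l"
    then obtain l where "AE \<omega> in M. k * Y \<omega> = l" by blast
    then have "AE \<omega> in M. Y \<omega> = l / k"
      by eventually_elim (use assms in auto)
    then show "\<exists>l. AE \<omega> in M. Y \<omega> = l" by blast
  next
    assume "\<exists>l. AE \<omega> in M. Y \<omega> = l"
    then obtain l where "AE \<omega> in M. Y \<omega> = l" by blast
    then have "AE \<omega> in M. k * Y \<omega> = k * l"
      by eventually_elim simp
    then show "\<exists>l. AE \<omega> in M. k * Y \<omega> = l" by blast
  qed
  then show ?thesis by (simp add: nondegenerate_def)
qed

section \<open>Independence and laws along one edge\<close>

context
  fixes V :: "'v set" and E :: "'v set set" and C :: "'v \<Rightarrow> 'v \<Rightarrow> real"
    and M :: "'w measure" and X :: "'v \<Rightarrow> 'w \<Rightarrow> real"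
  assumes T: "is_tree V E"
    and C_sym: "\<And>i j. i \<in> V \<Longrightarrow> j \<in> V \<Longrightarrow> C i j = C j i"
    and C_diag: "\<And>i. i \<in> V \<Longrightarrow> C i i > 0"
    and C_edge: "\<And>i j. {i, j} \<in> E \<Longrightarrow> C i j > 0"
    and prob: "prob_space M"
    and X_meas: "\<And>i. i \<in> V \<Longrightarrow> X i \<in> borel_measurable M"
    and X_pos: "\<And>i \<omega>. i \<in> V \<Longrightarrow> 0 < X i \<omega>"
    and indep: "\<And>r. leaf V E r \<Longrightarrow>
      prob_space.indep_vars M (\<lambda>_. borel) (\<lambda>i \<omega>. Phi V E C r (\<lambda>j. X j \<omega>) i) V"
begin

interpretation prob_space M by (rule prob)

abbreviation (input) Phi_comp :: "'v \<Rightarrow> 'v \<Rightarrow> 'w \<Rightarrow> real" where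
  "Phi_comp r i \<omega> \<equiv> Phi V E C r (\<lambda>j. X j \<omega>) i"

lemma Phi_comp_pos: "i \<in> V \<Longrightarrow> 0 < Phi_comp r i \<omega>"
  by (rule Phi_pos[OF T]) (auto simp: X_pos C_diag C_edge)

lemma Phi_comp_measurable: "i \<in> V \<Longrightarrow> Phi_comp r i \<in> borel_measurable M"
  by (rule Phi_measurable[OF T X_meas])

text \<open>Moving the root along the path from \<open>r\<close> to \<open>i\<close> one edge \<open>{p, i}\<close> at a time expresses \<open>F i\<close> through
  \<open>F p\<close> and the component at \<open>i\<close> of the transformation rooted at \<open>r\<close>.\<close>

lemma Phi_comp_self_measurable_function:
  assumes r: "r \<in> V" and "i \<in> V"
  shows "\<exists>f \<in> borel_measurable (PiM {v \<in> V. graph_dist V E r v \<le> graph_dist V E r i} (\<lambda>_. borel)).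
    \<forall>\<omega>. Phi_comp i i \<omega> = f (restrict (\<lambda>v. Phi_comp r v \<omega>) {v \<in> V. graph_dist V E r v \<le> graph_dist V E r i})"
  using assms(2)
proof (induction "graph_dist V E r i" arbitrary: i)
  case 0
  then have i: "i = r"
    using graph_dist_eq_0_iff[OF T r] by simp
  let ?A = "{v \<in> V. graph_dist V E r v \<le> graph_dist V E r i}"
  have "i \<in> ?A" using 0 by simp
  then show ?case
    by (intro bexI[of _ "\<lambda>x. x i"]) (auto simp: i)
next
  case (Suc n)
  have "i \<noteq> r" using Suc.hyps(2) graph_dist_self[OF T r] by auto
  then obtain p where p: "p \<in> V" "i \<in> children V E r p"
    using ex_parent[OF tree_connected[OF T] r Suc.prems] by blast
  then have pi: "{p, i} \<in> E" and dp: "n = graph_dist V E r p"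
    using Suc.hyps(2) by (auto simp: children_def)
  let ?A = "{v \<in> V. graph_dist V E r v \<le> graph_dist V E r p}"
  let ?B = "{v \<in> V. graph_dist V E r v \<le> graph_dist V E r i}"
  have AB: "?A \<subseteq> ?B" "i \<in> ?B"
    using Suc.prems Suc.hyps(2) dp by auto
  obtain f where f: "f \<in> borel_measurable (PiM ?A (\<lambda>_. borel))"
    "\<And>\<omega>. Phi_comp p p \<omega> = f (restrict (\<lambda>v. Phi_comp r v \<omega>) ?A)"
    using Suc.hyps(1)[OF dp p(1)] by blast
  \<comment> \<open>\<open>Phi_edge\<close> from \<open>p\<close> to \<open>i\<close>, solved for
    the component at \<open>p\<close> rooted at \<open>i\<close>, is inserted into
    \<open>Phi_edge\<close> from \<open>i\<close> to \<open>p\<close>.\<close>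
  define f' where "f' x = x i * (1 + C i p / C i i * (f (restrict x ?A) / (1 + C p i / C p p * x i)))" for x
  have comp: "(\<lambda>x. x i) \<in> borel_measurable (PiM ?B (\<lambda>_. borel))"
    by (rule measurable_component_singleton[OF AB(2)])
  have "(\<lambda>x. f (restrict x ?A)) \<in> borel_measurable (PiM ?B (\<lambda>_. borel))"
    by (rule measurable_compose[OF measurable_restrict_subset[OF AB(1)] f(1)])
  then have f': "f' \<in> borel_measurable (PiM ?B (\<lambda>_. borel))"
    unfolding f'_def[abs_def]
    by (intro borel_measurable_times borel_measurable_add borel_measurable_divide borel_measurable_const comp)
  have "Phi_comp i i \<omega> = f' (restrict (\<lambda>v. Phi_comp r v \<omega>) ?B)" for \<omega>
  proof -
    have pir: "Phi_comp p i \<omega> = Phi_comp r i \<omega>"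
      by (rule Phi_change_root[OF T p(1) r child_at_neighbour[OF T pi] p(2)])
    have "0 < 1 + C p i / C p p * Phi_comp p i \<omega>"
      using C_edge[OF pi] C_diag[OF p(1)] Phi_comp_pos[OF Suc.prems, of p \<omega>] by (simp add: add_pos_pos)
    then have "Phi_comp i p \<omega> = Phi_comp p p \<omega> / (1 + C p i / C p p * Phi_comp p i \<omega>)"
      using Phi_edge[OF T pi, of C "\<lambda>j. X j \<omega>"] by simp
    moreover have "restrict (restrict (\<lambda>v. Phi_comp r v \<omega>) ?B) ?A = restrict (\<lambda>v. Phi_comp r v \<omega>) ?A"
      using AB(1) by (auto simp: restrict_def fun_eq_iff)
    ultimately show ?thesis
      using Phi_edge[OF T edge_commute[OF pi], of C "\<lambda>j. X j \<omega>"] AB(2)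
      by (simp add: f'_def f(2)[symmetric] pir)
  qed
  with f' show ?case by blast
qed

text \<open>For a leaf root \<open>r\<close> behind \<open>i\<close>, \<open>j\<close> is a child of
  \<open>i\<close> and hence farther from \<open>r\<close>. So the component at \<open>i\<close>
  rooted at \<open>i\<close> is a function of components rooted at \<open>r\<close> among which
  \<open>j\<close> does not occur.\<close>

lemma edge_independent:
  assumes e: "{i, j} \<in> E"
  shows "indep_var borel (Phi_comp i j) borel (Phi_comp i i)"
proof -
  note V = edge_vertices[OF T e]
  obtain r where r: "leaf V E r" "j \<in> children V E r i"
    by (rule ex_leaf_behind[OF T e])
  then have rV: "r \<in> V" by (simp add: leaf_def)
  let ?B = "{v \<in> V. graph_dist V E r v \<le> graph_dist V E r i}"
  obtain f where f: "f \<in> borel_measurable (PiM ?B (\<lambda>_. borel))"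
    "\<And>\<omega>. Phi_comp i i \<omega> = f (restrict (\<lambda>v. Phi_comp r v \<omega>) ?B)"
    using Phi_comp_self_measurable_function[OF rV V(1)] by blast
  have "j \<notin> ?B" using r(2) by (simp add: children_def)
  then have "indep_var (PiM {j} (\<lambda>_. borel)) (\<lambda>\<omega>. restrict (\<lambda>v. Phi_comp r v \<omega>) {j})
      (PiM ?B (\<lambda>_. borel)) (\<lambda>\<omega>. restrict (\<lambda>v. Phi_comp r v \<omega>) ?B)"
    by (intro indep_var_restrict[OF indep[OF r(1)]]) (use V in auto)
  from indep_var_compose[OF this, of "\<lambda>x. x j" borel f borel] f(1)
  have "indep_var borel (\<lambda>\<omega>. Phi_comp r j \<omega>) borel (\<lambda>\<omega>. f (restrict (\<lambda>v. Phi_comp r v \<omega>) ?B))"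
    by (simp add: comp_def)
  moreover have "Phi_comp r j \<omega> = Phi_comp i j \<omega>" for \<omega>
    by (rule Phi_change_root[OF T rV V(1) r(2) child_at_neighbour[OF T e]])
  ultimately show ?thesis
    by (simp add: f(2)[symmetric])
qed

context
  fixes i j assumes e: "{i, j} \<in> E"
begin

lemma edge_coefficients: "0 < C i j / C i i" "0 < C i j / C j j" "C j i = C i j"
  using C_edge[OF e] C_diag edge_vertices[OF T e] C_sym by auto

text \<open>These factors remove the coefficients from \<open>Phi_edge\<close> in both directions.
  The conclusions are ordered like the assumptions on \<open>X\<close>, \<open>Y\<close>,
  \<open>U\<close>, \<open>V\<close> of the independence property, so that they can discharge them
  all at once.\<close>

lemma edge_setup:
  shows "indep_var borel (\<lambda>\<omega>. C i j / C i i * Phi_comp i j \<omega>) borel (\<lambda>\<omega>. C i j / C j j * Phi_comp i i \<omega>)"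
    and "indep_var borel (\<lambda>\<omega>. C i j / C j j * Phi_comp j i \<omega>) borel (\<lambda>\<omega>. C i j / C i i * Phi_comp j j \<omega>)"
    and "0 < C i j / C i i * Phi_comp i j \<omega>" and "0 < C i j / C j j * Phi_comp j i \<omega>"
    and "C i j / C j j * Phi_comp i i \<omega> = C i j / C j j * Phi_comp j i \<omega> * (1 + C i j / C i i * Phi_comp i j \<omega>)"
    and "C i j / C i i * Phi_comp j j \<omega> = C i j / C i i * Phi_comp i j \<omega> * (1 + C i j / C j j * Phi_comp j i \<omega>)"
proof -
  note V = edge_vertices[OF T e]
  show "indep_var borel (\<lambda>\<omega>. C i j / C i i * Phi_comp i j \<omega>) borel (\<lambda>\<omega>. C i j / C j j * Phi_comp i i \<omega>)"
    using indep_var_compose[OF edge_independent[OF e], of "\<lambda>x. C i j / C i i * x" borel "\<lambda>x. C i j / C j j * x" borel]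
    by (simp add: comp_def)
  show "indep_var borel (\<lambda>\<omega>. C i j / C j j * Phi_comp j i \<omega>) borel (\<lambda>\<omega>. C i j / C i i * Phi_comp j j \<omega>)"
    using indep_var_compose[OF edge_independent[OF edge_commute[OF e]], of "\<lambda>x. C i j / C j j * x" borel "\<lambda>x. C i j / C i i * x" borel]
    by (simp add: comp_def)
  show "0 < C i j / C i i * Phi_comp i j \<omega>" "0 < C i j / C j j * Phi_comp j i \<omega>"
    by (intro mult_pos_pos edge_coefficients Phi_comp_pos V)+
  show "C i j / C j j * Phi_comp i i \<omega> = C i j / C j j * Phi_comp j i \<omega> * (1 + C i j / C i i * Phi_comp i j \<omega>)"
    by (subst Phi_edge[OF T e]) (rule mult.assoc[symmetric])
  show "C i j / C i i * Phi_comp j j \<omega> = C i j / C i i * Phi_comp i j \<omega> * (1 + C i j / C j j * Phi_comp j i \<omega>)"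
    by (subst Phi_edge[OF T edge_commute[OF e]]) (simp only: mult.assoc edge_coefficients(3))
qed

lemmas edge_scale = edge_coefficients(1,2)[THEN less_imp_neq, symmetric, THEN nondegenerate_scale]

lemma edge_nondegenerate_iff: "nondegenerate M (Phi_comp i i) \<longleftrightarrow> nondegenerate M (Phi_comp j j)"
  using nondegenerate_V_iff[OF edge_setup] unfolding edge_scale by blast

lemma edge_nondegenerate:
  assumes "nondegenerate M (Phi_comp i j)"
  shows "nondegenerate M (Phi_comp i i)"
  using nondegenerate_Y[OF edge_setup] assms unfolding edge_scale by blast

lemma edge_laws:
  assumes "nondegenerate M (Phi_comp i i)"
  obtains a b c where "0 < a" "0 < b" "0 < c"
    "gamma_ratio M (Phi_comp i i) b (C i j / C j j * c)" "gamma_ratio M (Phi_comp j j) a (C i j / C i i * c)"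
    "distributed M lborel (\<lambda>\<omega>. C i j / C i i * Phi_comp i j \<omega>) (kummer_density a (b - a) c)"
proof -
  have "nondegenerate M (\<lambda>\<omega>. C i j / C j j * Phi_comp i i \<omega>)"
    using assms unfolding edge_scale .
  from kummer_gamma_characterization[OF edge_setup this] obtain a b c where
    abc: "0 < a" "0 < b" "0 < c" "gamma_ratio M (\<lambda>\<omega>. C i j / C j j * Phi_comp i i \<omega>) b c"
    "gamma_ratio M (\<lambda>\<omega>. C i j / C i i * Phi_comp j j \<omega>) a c"
    "distributed M lborel (\<lambda>\<omega>. C i j / C i i * Phi_comp i j \<omega>) (kummer_density a (b - a) c)"
    by blast
  show thesis
    by (rule that[OF abc(1-3) gamma_ratio_scale[OF abc(4) edge_coefficients(2)]
          gamma_ratio_scale[OF abc(5) edge_coefficients(1)] abc(6)])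
qed

end

text \<open>Seen from its neighbour, a leaf has no children, so the product is empty. This is where
  nondegeneracy of the given vector enters the transformed one.\<close>

lemma leaf_neighbour:
  assumes "leaf V E r"
  obtains q where "{q, r} \<in> E" "Phi_comp q r = X r"
proof -
  have rV: "r \<in> V" and "card {e \<in> E. r \<in> e} = 1"
    using assms by (auto simp: leaf_def vertex_degree_def)
  then obtain e where e: "{e \<in> E. r \<in> e} = {e}"
    by (auto simp: card_1_singleton_iff)
  have eE: "e \<in> E" "r \<in> e"
    using e by (auto simp: set_eq_iff)
  obtain a b where "e = {a, b}"
    using eE(1) tree_simple[OF T] unfolding simple_graph_def by blast
  with eE(2) obtain q where q: "e = {q, r}"
    by (auto simp: insert_commute)
  have qE: "{q, r} \<in> E" using eE(1) q by simp
  have "children V E q r = {l. {r, l} \<in> E} - {q}"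
    by (rule children_nonroot[OF T edge_vertices(1)[OF T qE] child_at_neighbour[OF T qE]])
  also have "\<dots> = {}"
  proof -
    have "l = q" if "{r, l} \<in> E" for l
    proof -
      have "{r, l} \<in> {e \<in> E. r \<in> e}" using that by simp
      then have "{r, l} = {q, r}" unfolding e q by simp
      then show ?thesis by (auto simp: doubleton_eq_iff)
    qed
    then show ?thesis by auto
  qed
  finally have "Phi_comp q r = X r"
    by (subst Phi_rec[OF tree_simple[OF T]]) simp
  with qE show thesis by (rule that)
qed

section \<open>Gluing the edge laws along the tree\<close>

text \<open>Nondegeneracy starts at the neighbour of a leaf and spreads across edges. Shape
  \<open>a i\<close> and rate \<open>l i\<close> are chosen from one edge at \<open>i\<close>;
  uniqueness of gamma parameters makes every other edge at \<open>i\<close> agree with them, and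
  connectedness makes \<open>l i / C i i\<close> a single constant \<open>c\<close>.\<close>

theorem kummer_gamma_laws_of_positive:
  assumes card: "card V \<ge> 2" and nondeg: "\<And>i. i \<in> V \<Longrightarrow> nondegenerate M (X i)"
  shows "\<exists>(a :: 'v \<Rightarrow> real) (c :: real).
    (\<forall>i\<in>V. a i > 0) \<and> c > 0 \<and>
    (\<forall>r. leaf V E r \<longrightarrow>
      distributed M lborel (Phi_comp r r) (gamma_density (a r) (c * C r r)) \<and>
      (\<forall>i\<in>V - {r}. let p = parent V E r i in
        distributed M lborel (\<lambda>\<omega>. C p i / C p p * Phi_comp r i \<omega>)
          (kummer_density (a i) (a p - a i) (c * (C p p * C i i / C p i)))))"
proof -
  have nb: "\<exists>j. {i, j} \<in> E" if i: "i \<in> V" for i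
  proof -
    obtain v where v: "v \<in> V" "v \<noteq> i"
      using card i by (metis One_nat_def card_1_singleton_iff is_singletonI' is_singleton_def
          not_less_eq_eq numeral_2_eq_2 order_refl empty_iff)
    then obtain p where "i \<in> children V E v p"
      using ex_parent[OF tree_connected[OF T] v(1) i] by blast
    then have "{i, p} \<in> E"
      by (rule edge_commute[OF children_edge])
    then show ?thesis ..
  qed
  obtain v0 where v0: "v0 \<in> V" using card by fastforce
  then obtain w0 where "{v0, w0} \<in> E" using nb by blast
  then obtain r0 where r0: "leaf V E r0"
    by (rule ex_leaf_behind[OF T])
  then obtain q where q: "{q, r0} \<in> E" "Phi_comp q r0 = X r0"
    by (rule leaf_neighbour)
  have "nondegenerate M (Phi_comp q q)"
    by (rule edge_nondegenerate[OF q(1)]) (use nondeg edge_vertices(2)[OF T q(1)] q(2) in simp)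
  then have nd: "nondegenerate M (Phi_comp i i)" if "i \<in> V" for i
    using edge_preserved_constant[where f = "\<lambda>i. nondegenerate M (Phi_comp i i)",
        OF T edge_nondegenerate_iff that edge_vertices(1)[OF T q(1)]]
    by blast
  have "\<exists>a l. 0 < a \<and> 0 < l \<and> gamma_ratio M (Phi_comp i i) a l" if i: "i \<in> V" for i
  proof -
    obtain j where j: "{i, j} \<in> E" using nb[OF i] by blast
    from edge_laws[OF j nd[OF i]] show ?thesis
      using edge_coefficients(2)[OF j] by (metis mult_pos_pos)
  qed
  then obtain a l where al: "\<And>i. i \<in> V \<Longrightarrow> 0 < a i" "\<And>i. i \<in> V \<Longrightarrow> 0 < l i"
      "\<And>i. i \<in> V \<Longrightarrow> gamma_ratio M (Phi_comp i i) (a i) (l i)"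
    by metis
  have edge: "l i / C i i = l j / C j j \<and>
      distributed M lborel (\<lambda>\<omega>. C i j / C i i * Phi_comp i j \<omega>)
        (kummer_density (a j) (a i - a j) (l i / C i i * (C i i * C j j / C i j)))"
    if e: "{i, j} \<in> E" for i j
  proof -
    note V = edge_vertices[OF T e]
    obtain a' b' k where k: "gamma_ratio M (Phi_comp i i) b' (C i j / C j j * k)"
      "gamma_ratio M (Phi_comp j j) a' (C i j / C i i * k)"
      "distributed M lborel (\<lambda>\<omega>. C i j / C i i * Phi_comp i j \<omega>) (kummer_density a' (b' - a') k)"
      by (rule edge_laws[OF e nd[OF V(1)]])
    have "b' = a i \<and> C i j / C j j * k = l i"
      by (rule gamma_ratio_unique[OF Phi_comp_measurable Phi_comp_pos k(1) al(3)]) (rule V)+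
    moreover have "a' = a j \<and> C i j / C i i * k = l j"
      by (rule gamma_ratio_unique[OF Phi_comp_measurable Phi_comp_pos k(2) al(3)]) (rule V)+
    \<comment> \<open>Divided by the diagonal coefficients of their vertices, the rates at both ends
      become the same expression, symmetric in \<open>i\<close> and \<open>j\<close>.\<close>
    moreover have "C i j / C j j * k / C i i = C i j / C i i * k / C j j"
      by simp
    moreover have "C i j / C j j * k / C i i * (C i i * C j j / C i j) = k"
      using C_edge[OF e] C_diag[OF V(1)] C_diag[OF V(2)] by simp
    ultimately show ?thesis using k(3) by metis
  qed
  define c where "c = l v0 / C v0 v0"
  have c: "l i / C i i = c" if "i \<in> V" for i
    unfolding c_def
    by (rule edge_preserved_constant[OF T _ that v0]) (use edge in blast)
  have c_pos: "0 < c" unfolding c_def using al(2) C_diag v0 by simp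
  have "distributed M lborel (Phi_comp r r) (gamma_density (a r) (c * C r r))" if r: "r \<in> V" for r
  proof -
    have "c * C r r = l r" using c[OF r, symmetric] C_diag[OF r] by simp
    then show ?thesis
      using gamma_ratio_distributed(2)[OF Phi_comp_measurable[OF r] Phi_comp_pos[OF r] al(3)[OF r] al(1)[OF r] al(2)[OF r]]
      by simp
  qed
  moreover have "distributed M lborel (\<lambda>\<omega>. C p i / C p p * Phi_comp r i \<omega>)
      (kummer_density (a i) (a p - a i) (c * (C p p * C i i / C p i)))"
    if r: "r \<in> V" and i: "i \<in> V - {r}" and p: "p = parent V E r i" for r i p
  proof -
    have ch: "i \<in> children V E r p"
      using children_parent[OF T r] i p by simp
    note pi = children_edge[OF ch]
    note V = edge_vertices[OF T pi]
    \<comment> \<open>The component at \<open>i\<close> is the same for the roots \<open>r\<close>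
      and \<open>p\<close>, so the law of the edge from \<open>p\<close> to \<open>i\<close>
      applies.\<close>
    have "Phi_comp r i \<omega> = Phi_comp p i \<omega>" for \<omega>
      by (rule Phi_change_root[OF T r V(1) ch child_at_neighbour[OF T pi]])
    then show ?thesis using conjunct2[OF edge[OF pi]] unfolding c[OF V(1)] by (simp only:)
  qed
  ultimately show ?thesis
    using al(1) c_pos by (intro exI[of _ a] exI[of _ c]) (auto simp: Let_def leaf_def)
qed

end

section \<open>From everywhere positive to almost surely positive components\<close>

text \<open>Independence says that the joint law is the product of the marginal laws, and laws do
  not see null sets. Finiteness of \<open>I\<close> merges the exceptional sets into one.\<close>

lemma (in prob_space) indep_vars_cong_AE:
  assumes ind: "indep_vars N X I" and I: "finite I" "I \<noteq> {}"
    and Y: "\<And>i. i \<in> I \<Longrightarrow> Y i \<in> measurable M (N i)"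
    and eq: "\<And>i. i \<in> I \<Longrightarrow> AE \<omega> in M. X i \<omega> = Y i \<omega>"
  shows "indep_vars N Y I"
proof -
  have X: "X i \<in> measurable M (N i)" if "i \<in> I" for i
    using ind that by (auto simp: indep_vars_def)
  have "AE \<omega> in M. \<forall>i\<in>I. X i \<omega> = Y i \<omega>"
    using I(1) eq by (simp add: AE_finite_all)
  then have "distr M (PiM I N) (\<lambda>\<omega>. \<lambda>i\<in>I. Y i \<omega>) = distr M (PiM I N) (\<lambda>\<omega>. \<lambda>i\<in>I. X i \<omega>)"
    by (intro distr_cong_AE refl measurable_restrict X Y) (auto elim!: eventually_mono simp: restrict_def)
  also have "\<dots> = PiM I (\<lambda>i. distr M (N i) (X i))"
    using ind indep_vars_iff_distr_eq_PiM'[where X = X and M' = N, OF I(2) X] by blast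
  also have "\<dots> = PiM I (\<lambda>i. distr M (N i) (Y i))"
    by (intro PiM_cong refl distr_cong_AE eq X Y) auto
  finally show ?thesis
    using indep_vars_iff_distr_eq_PiM'[where X = Y and M' = N, OF I(2) Y] by blast
qed

lemma distributed_cong_AE:
  assumes "distributed M N X f" "Y \<in> measurable M N" "AE \<omega> in M. X \<omega> = Y \<omega>"
  shows "distributed M N Y f"
proof -
  have "distr M N Y = distr M N X"
    using assms by (intro distr_cong_AE) (auto simp: distributed_def)
  then show ?thesis using assms by (simp add: distributed_def)
qed

theorem corollary2p6:
  fixes V :: "'v set" and E :: "'v set set" and C :: "'v \<Rightarrow> 'v \<Rightarrow> real"
    and M :: "'w measure" and X :: "'v \<Rightarrow> 'w \<Rightarrow> real"
  assumes tree: "is_tree V E"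
    and card: "card V \<ge> 2"
    and C_sym: "\<And>i j. i \<in> V \<Longrightarrow> j \<in> V \<Longrightarrow> C i j = C j i"
    and C_diag: "\<And>i. i \<in> V \<Longrightarrow> C i i > 0"
    and C_edge: "\<And>i j. {i, j} \<in> E \<Longrightarrow> C i j > 0"
    and prob: "prob_space M"
    and X_meas: "\<And>i. i \<in> V \<Longrightarrow> X i \<in> borel_measurable M"
    and X_pos: "\<And>i. i \<in> V \<Longrightarrow> AE \<omega> in M. X i \<omega> > 0"
    and X_nondeg: "\<And>i. i \<in> V \<Longrightarrow> nondegenerate M (X i)"
    and indep: "\<And>r. leaf V E r \<Longrightarrow>
      prob_space.indep_vars M (\<lambda>_. borel) (\<lambda>i \<omega>. Phi V E C r (\<lambda>j. X j \<omega>) i) V"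
  shows "\<exists>(a :: 'v \<Rightarrow> real) (c :: real).
    (\<forall>i\<in>V. a i > 0) \<and> c > 0 \<and>
    (\<forall>r. leaf V E r \<longrightarrow>
      distributed M lborel (\<lambda>\<omega>. Phi V E C r (\<lambda>j. X j \<omega>) r)
        (gamma_density (a r) (c * C r r)) \<and>
      (\<forall>i\<in>V - {r}. let p = parent V E r i in
        distributed M lborel (\<lambda>\<omega>. C p i / C p p * Phi V E C r (\<lambda>j. X j \<omega>) i)
          (kummer_density (a i) (a p - a i) (c * (C p p * C i i / C p i)))))"
proof -
  interpret prob_space M by (rule prob)
  \<comment> \<open>Replacing nonpositive values by 1 changes each component on a null set only and
    gives the pointwise positivity required by \<open>kummer_gamma_laws_of_positive\<close>.\<close>
  define X' where "X' i \<omega> = (if 0 < X i \<omega> then X i \<omega> else 1)" for i \<omega>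
  have fin: "finite V" "V \<noteq> {}"
    using card by (auto intro: card_ge_0_finite)
  have X'_meas: "X' i \<in> borel_measurable M" if "i \<in> V" for i
    using X_meas[OF that] unfolding X'_def[abs_def] by measurable
  have "AE \<omega> in M. \<forall>i\<in>V. 0 < X i \<omega>"
    using fin(1) X_pos by (simp add: AE_finite_all)
  then have eq: "AE \<omega> in M. \<forall>i\<in>V. X i \<omega> = X' i \<omega>"
    by eventually_elim (simp add: X'_def)
  have Phi_eq: "AE \<omega> in M. Phi V E C r (\<lambda>j. X j \<omega>) i = Phi V E C r (\<lambda>j. X' j \<omega>) i" if "i \<in> V" for r i
    using eq by eventually_elim (auto intro: Phi_cong[OF tree _ that])
  have indep': "indep_vars (\<lambda>_. borel) (\<lambda>i \<omega>. Phi V E C r (\<lambda>j. X' j \<omega>) i) V" if "leaf V E r" for r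
    by (rule indep_vars_cong_AE[OF indep[OF that] fin Phi_measurable[OF tree X'_meas] Phi_eq])
  have nondeg': "nondegenerate M (X' i)" if i: "i \<in> V" for i
  proof -
    have "AE \<omega> in M. X i \<omega> = k" if "AE \<omega> in M. X' i \<omega> = k" for k
      using eq that by eventually_elim (use i in auto)
    then show ?thesis
      using X_nondeg[OF i] by (auto simp: nondegenerate_def)
  qed
  \<comment> \<open>\<open>k = 1\<close> serves the gamma laws, \<open>k = C p i / C p p\<close> the
    Kummer laws.\<close>
  have transfer: "distributed M lborel (\<lambda>\<omega>. k * Phi V E C r (\<lambda>j. X j \<omega>) i) f"
    if "distributed M lborel (\<lambda>\<omega>. k * Phi V E C r (\<lambda>j. X' j \<omega>) i) f" "i \<in> V" for k r i f
  proof (rule distributed_cong_AE[OF that(1)])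
    show "(\<lambda>\<omega>. k * Phi V E C r (\<lambda>j. X j \<omega>) i) \<in> measurable M lborel"
      using Phi_measurable[OF tree X_meas that(2)] by simp
    show "AE \<omega> in M. k * Phi V E C r (\<lambda>j. X' j \<omega>) i = k * Phi V E C r (\<lambda>j. X j \<omega>) i"
    proof -
      have "AE \<omega> in M. Phi V E C r (\<lambda>j. X j \<omega>) i = Phi V E C r (\<lambda>j. X' j \<omega>) i"
        by (rule Phi_eq) (rule that(2))
      then show ?thesis by eventually_elim simp
    qed
  qed
  have X'_pos: "0 < X' i \<omega>" for i \<omega> by (simp add: X'_def)
  from kummer_gamma_laws_of_positive[OF tree C_sym C_diag C_edge prob X'_meas X'_pos indep' card nondeg']
  obtain a c where ac: "\<forall>i\<in>V. 0 < a i" "0 < c"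
    and G: "\<And>r. leaf V E r \<Longrightarrow> distributed M lborel (\<lambda>\<omega>. Phi V E C r (\<lambda>j. X' j \<omega>) r) (gamma_density (a r) (c * C r r))"
    and K: "\<And>r i. leaf V E r \<Longrightarrow> i \<in> V - {r} \<Longrightarrow> let p = parent V E r i in
        distributed M lborel (\<lambda>\<omega>. C p i / C p p * Phi V E C r (\<lambda>j. X' j \<omega>) i)
          (kummer_density (a i) (a p - a i) (c * (C p p * C i i / C p i)))"
    by blast
  have "distributed M lborel (\<lambda>\<omega>. Phi V E C r (\<lambda>j. X j \<omega>) r) (gamma_density (a r) (c * C r r))"
    if "leaf V E r" for r
    using transfer[of 1 r r] G[OF that] that by (simp add: leaf_def)
  moreover have "let p = parent V E r i in
        distributed M lborel (\<lambda>\<omega>. C p i / C p p * Phi V E C r (\<lambda>j. X j \<omega>) i)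
          (kummer_density (a i) (a p - a i) (c * (C p p * C i i / C p i)))"
    if "leaf V E r" "i \<in> V - {r}" for r i
    using K[OF that] that(2) unfolding Let_def by (intro transfer) auto
  ultimately show ?thesis
    using ac by blast
qed

end
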